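(* Let $(X,g)$ be a complete noncompact Riemannian manifold. Assume that $\alpha>0$, $\beta>0$, $a_0$, $a_1$ and $a_2$ are constants satisfying $a_2<\frac\beta4$. If $h$ is a proper nonnegative $C^2$ function on $X$ such that $$\Delta h-\alpha|\nabla h|^2+\beta h\le a_2r^2+a_1r+a_0$$ and $$\Delta h\le a_2r^2+a_1r+a_0$$ hold on the sets $D_r=\{x\in X:\ 2\sqrt{h(x)}\le r\}$ for all $r>0$, then: (i) $\displaystyle\int_Xe^{-\alpha h}\,dv<\infty$. (ii) For all $r>0$ the volume $V(r)$ of the set $D_r$ satisfies $$V(r)\le Ce^{\varepsilon(a_2r^2+a_1r+a_0)+\frac{\alpha r^2}{4e^{\varepsilon\gamma}}}\quad\text{for any }\varepsilon>0,$$ and $$V(r)\le Ce^{\frac\alpha4r^2},$$ where $\gamma=\frac\beta\alpha$ and $C=C(\alpha)=\int_Xe^{-\alpha h}\,dv<\infty$.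
   Context: A function $h$ on a complete noncompact Riemannian manifold $X$ is proper if for every bounded closed subset $I\subset\mathbb{R}$ the inverse image $h^{-1}(I)$ is compact in $X$. $\Delta$, $\nabla$ and $dv$ are the Laplacian ($\Delta=\mathrm{div}\,\nabla$), gradient and volume element of $g$. *)

theory Defs
  imports "HOL-Analysis.Analysis"
begin

section \<open>Functions of class \<open>C\<^sup>k\<close> on open subsets of Euclidean space\<close>

text \<open>
  Only meant for open \<open>S\<close>, where differentiability within \<open>S\<close> and the unrestricted
  derivative agree.
\<close>

primrec Ck_on :: "nat \<Rightarrow> ('e::euclidean_space \<Rightarrow> 'f::real_normed_vector) \<Rightarrow> 'e set \<Rightarrow> bool" where
  "Ck_on 0 f S \<longleftrightarrow> continuous_on S f"
| "Ck_on (Suc k) f S \<longleftrightarrow>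
     f differentiable_on S \<and> (\<forall>v. Ck_on k (\<lambda>x. frechet_derivative f (at x) v) S)"

definition smooth_on :: "('e::euclidean_space \<Rightarrow> 'f::real_normed_vector) \<Rightarrow> 'e set \<Rightarrow> bool" where
  "smooth_on f S \<longleftrightarrow> (\<forall>k. Ck_on k f S)"

definition partial :: "'n::finite \<Rightarrow> (real^'n \<Rightarrow> real) \<Rightarrow> real^'n \<Rightarrow> real" where
  "partial i f x = frechet_derivative f (at x) (axis i 1)"


section \<open>Smooth manifolds\<close>

text \<open>
  The manifold is the whole type \<open>'a\<close>; the Hausdorff and second countability axioms are imposed
  by the sort of \<open>'a\<close>. A chart is a pair of its domain and its coordinate map, the values of
  the map outside the domain being irrelevant. An atlas need not be maximal.
\<close>

type_synonym ('a, 'n) chart = "'a set \<times> ('a \<Rightarrow> real^'n)"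

abbreviation chart_dom :: "('a, 'n) chart \<Rightarrow> 'a set" where
  "chart_dom c \<equiv> fst c"

abbreviation chart_map :: "('a, 'n) chart \<Rightarrow> 'a \<Rightarrow> real^'n" where
  "chart_map c \<equiv> snd c"

abbreviation chart_img :: "('a, 'n) chart \<Rightarrow> (real^'n) set" where
  "chart_img c \<equiv> chart_map c ` chart_dom c"

definition chart_inv :: "('a, 'n) chart \<Rightarrow> real^'n \<Rightarrow> 'a" where
  "chart_inv c = inv_into (chart_dom c) (chart_map c)"

definition is_chart :: "('a::topological_space, 'n::finite) chart \<Rightarrow> bool" where
  "is_chart c \<longleftrightarrow> open (chart_dom c) \<and> open (chart_img c) \<and>
     homeomorphism (chart_dom c) (chart_img c) (chart_map c) (chart_inv c)"

definition transition :: "('a, 'n) chart \<Rightarrow> ('a, 'n) chart \<Rightarrow> real^'n \<Rightarrow> real^'n" where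
  "transition c d = chart_map d \<circ> chart_inv c"

definition smooth_atlas ::
  "('a::{t2_space, second_countable_topology}, 'n::finite) chart set \<Rightarrow> bool" where
  "smooth_atlas \<A> \<longleftrightarrow>
     (\<forall>c\<in>\<A>. is_chart c) \<and> (\<Union>c\<in>\<A>. chart_dom c) = UNIV \<and>
     (\<forall>c\<in>\<A>. \<forall>d\<in>\<A>.
        smooth_on (transition c d) (chart_map c ` (chart_dom c \<inter> chart_dom d)))"

text \<open>
  An arbitrary chart around a point, used to evaluate expressions in local coordinates whose value
  does not depend on the chart.
\<close>

definition chart_at :: "('a, 'n) chart set \<Rightarrow> 'a \<Rightarrow> ('a, 'n) chart" where
  "chart_at \<A> p = (SOME c. c \<in> \<A> \<and> p \<in> chart_dom c)"

definition Ck_manifold ::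
  "nat \<Rightarrow> ('a, 'n::finite) chart set \<Rightarrow> ('a \<Rightarrow> real) \<Rightarrow> bool" where
  "Ck_manifold k \<A> f \<longleftrightarrow> (\<forall>c\<in>\<A>. Ck_on k (f \<circ> chart_inv c) (chart_img c))"


section \<open>Riemannian metrics\<close>

text \<open>
  A Riemannian metric is a smooth positive definite symmetric covariant 2-tensor field, given by
  its components: \<open>g c p\<close> is the Gram matrix \<open>(g\<^sub>i\<^sub>j)\<close> at \<open>p\<close> of the coordinate frame of the
  chart \<open>c\<close>. The last condition is the transformation law of such tensors.
\<close>

type_synonym ('a, 'n) metric = "('a, 'n) chart \<Rightarrow> 'a \<Rightarrow> real^'n^'n"

definition riemannian_manifold ::
  "('a::{t2_space, second_countable_topology}, 'n::finite) chart set \<Rightarrow> ('a, 'n) metric \<Rightarrow> bool" where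
  "riemannian_manifold \<A> g \<longleftrightarrow>
     smooth_atlas \<A> \<and>
     (\<forall>c\<in>\<A>. smooth_on (g c \<circ> chart_inv c) (chart_img c)) \<and>
     (\<forall>c\<in>\<A>. \<forall>p\<in>chart_dom c.
        transpose (g c p) = g c p \<and> (\<forall>v. v \<noteq> 0 \<longrightarrow> v \<bullet> (g c p *v v) > 0)) \<and>
     (\<forall>c\<in>\<A>. \<forall>d\<in>\<A>. \<forall>p\<in>chart_dom c \<inter> chart_dom d.
        let J = jacobian (transition c d) (at (chart_map c p))
        in g c p = transpose J ** g d p ** J)"


subsection \<open>Riemannian distance and completeness\<close>

definition piecewise_C1_curve ::
  "('a::topological_space, 'n::finite) chart set \<Rightarrow> (real \<Rightarrow> 'a) \<Rightarrow> bool" where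
  "piecewise_C1_curve \<A> \<gamma> \<longleftrightarrow> continuous_on {0..1} \<gamma> \<and>
     (\<exists>S. finite S \<and>
        (\<forall>c\<in>\<A>. (chart_map c \<circ> \<gamma>) C1_differentiable_on {t \<in> {0..1} - S. \<gamma> t \<in> chart_dom c}))"

definition speed ::
  "('a, 'n::finite) chart set \<Rightarrow> ('a, 'n) metric \<Rightarrow> (real \<Rightarrow> 'a) \<Rightarrow> real \<Rightarrow> real" where
  "speed \<A> g \<gamma> t =
     (let c = chart_at \<A> (\<gamma> t); v = vector_derivative (chart_map c \<circ> \<gamma>) (at t)
      in sqrt (v \<bullet> (g c (\<gamma> t) *v v)))"

definition curve_length ::
  "('a, 'n::finite) chart set \<Rightarrow> ('a, 'n) metric \<Rightarrow> (real \<Rightarrow> 'a) \<Rightarrow> ennreal" where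
  "curve_length \<A> g \<gamma> = (\<integral>\<^sup>+t\<in>{0..1}. ennreal (speed \<A> g \<gamma> t) \<partial>lborel)"

text \<open>The distance is \<open>\<infinity>\<close> between points of different connected components.\<close>

definition riemannian_dist ::
  "('a::topological_space, 'n::finite) chart set \<Rightarrow> ('a, 'n) metric \<Rightarrow> 'a \<Rightarrow> 'a \<Rightarrow> ennreal" where
  "riemannian_dist \<A> g p q =
     Inf {curve_length \<A> g \<gamma> | \<gamma>. piecewise_C1_curve \<A> \<gamma> \<and> \<gamma> 0 = p \<and> \<gamma> 1 = q}"

definition complete_riemannian ::
  "('a::topological_space, 'n::finite) chart set \<Rightarrow> ('a, 'n) metric \<Rightarrow> bool" where
  "complete_riemannian \<A> g \<longleftrightarrow>
     (\<forall>s :: nat \<Rightarrow> 'a.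
        (\<forall>e>0. \<exists>N. \<forall>m\<ge>N. \<forall>n\<ge>N. riemannian_dist \<A> g (s m) (s n) < e) \<longrightarrow>
        (\<exists>p. (\<lambda>n. riemannian_dist \<A> g (s n) p) \<longlonglongrightarrow> 0))"


subsection \<open>Gradient, divergence, Laplacian\<close>

text \<open>A vector field is given by its components in each chart.\<close>

type_synonym ('a, 'n) vector_field = "('a, 'n) chart \<Rightarrow> 'a \<Rightarrow> real^'n"

text \<open>In coordinates, \<open>(\<nabla>f)\<^sup>i = g\<^sup>i\<^sup>j \<partial>\<^sub>j f\<close>.\<close>

definition gradient ::
  "('a, 'n::finite) metric \<Rightarrow> ('a \<Rightarrow> real) \<Rightarrow> ('a, 'n) vector_field" where
  "gradient g f c p =
     matrix_inv (g c p) *v (\<chi> j. partial j (f \<circ> chart_inv c) (chart_map c p))"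

definition norm_sq ::
  "('a, 'n::finite) chart set \<Rightarrow> ('a, 'n) metric \<Rightarrow> ('a, 'n) vector_field \<Rightarrow> 'a \<Rightarrow> real" where
  "norm_sq \<A> g Y p = (let c = chart_at \<A> p in Y c p \<bullet> (g c p *v Y c p))"

definition vol_density :: "('a, 'n::finite) metric \<Rightarrow> ('a, 'n) chart \<Rightarrow> 'a \<Rightarrow> real" where
  "vol_density g c p = sqrt (det (g c p))"

text \<open>
  In coordinates, \<open>div Y = (1 / \<surd>det g) \<Sum>\<^sub>i \<partial>\<^sub>i (\<surd>det g Y\<^sup>i)\<close>.
\<close>

definition divergence ::
  "('a, 'n::finite) chart set \<Rightarrow> ('a, 'n) metric \<Rightarrow> ('a, 'n) vector_field \<Rightarrow> 'a \<Rightarrow> real" where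
  "divergence \<A> g Y p =
     (let c = chart_at \<A> p in
        (\<Sum>i\<in>UNIV. partial i
           (\<lambda>x. vol_density g c (chart_inv c x) * Y c (chart_inv c x) $ i) (chart_map c p))
        / vol_density g c p)"

definition laplacian ::
  "('a, 'n::finite) chart set \<Rightarrow> ('a, 'n) metric \<Rightarrow> ('a \<Rightarrow> real) \<Rightarrow> 'a \<Rightarrow> real" where
  "laplacian \<A> g f = divergence \<A> g (gradient g f)"


subsection \<open>Riemannian volume\<close>

text \<open>
  The volume measure is the unique Borel measure which in every chart is
  \<open>\<surd>det g dx\<^sub>1 \<dots> dx\<^sub>n\<close>.
\<close>

definition volume_measure ::
  "('a::topological_space, 'n::finite) chart set \<Rightarrow> ('a, 'n) metric \<Rightarrow> 'a measure" where
  "volume_measure \<A> g =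
     (THE M. sets M = sets borel \<and>
        (\<forall>c\<in>\<A>. \<forall>B\<in>sets borel. B \<subseteq> chart_dom c \<longrightarrow>
           emeasure M B =
             (\<integral>\<^sup>+x\<in>chart_map c ` B. ennreal (vol_density g c (chart_inv c x)) \<partial>lborel)))"


section \<open>Proper functions and their sublevel sets\<close>

definition proper_fun :: "('a::topological_space \<Rightarrow> real) \<Rightarrow> bool" where
  "proper_fun h \<longleftrightarrow> (\<forall>I. closed I \<and> bounded I \<longrightarrow> compact (h -` I))"

definition sublevel :: "('a \<Rightarrow> real) \<Rightarrow> real \<Rightarrow> 'a set" where
  "sublevel h r = {x. 2 * sqrt (h x) \<le> r}"

end

theory Submission
  imports Defs "HOL-Real_Asymp.Real_Asymp"
begin

text \<open>
  For \<open>0 < u \<le> 1\<close> the two hypotheses combine to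
  \<open>\<Delta>h - \<alpha>u|\<nabla>h|\<^sup>2 + \<beta>uh \<le> P(r)\<close> on \<open>D\<^sub>r\<close>, where \<open>P(r) = a\<^sub>2r\<^sup>2 + a\<^sub>1r + a\<^sub>0\<close>, while the
  integral of \<open>e\<^bsup>-\<alpha>uh\<^esup>(\<Delta>h - \<alpha>u|\<nabla>h|\<^sup>2) = div(e\<^bsup>-\<alpha>uh\<^esup>\<nabla>h)\<close> over the sublevel set \<open>D\<^sub>r\<close> is
  nonnegative. Hence \<open>J(u)\<close>, the integral of \<open>e\<^bsup>-\<alpha>uh\<^esup>\<close> over \<open>D\<^sub>r\<close>, satisfies
  \<open>-J'(u) \<le> (\<alpha>P(r)/\<beta>u) J(u)\<close>, so \<open>J(e\<^bsup>-\<epsilon>\<gamma>\<^esup>) \<le> e\<^bsup>\<epsilon>P(r)\<^esup> J(1)\<close>, and \<open>h \<le> r\<^sup>2/4\<close> on \<open>D\<^sub>r\<close>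
  gives the volume bound with \<open>J(1)\<close> in place of \<open>C\<close>. For small \<open>\<epsilon>\<close> the condition
  \<open>a\<^sub>2 < \<beta>/4\<close> makes the contribution of the shell \<open>D\<^sub>k - D\<^bsub>k-1\<^esub>\<close> to \<open>J(1)\<close> at most
  \<open>J(1)/k\<^sup>2\<close> for large \<open>k\<close>, whence \<open>C < \<infinity>\<close>.

  Green's formula is obtained in charts from the translation invariance of Lebesgue measure, and
  globally with a partition of unity.
\<close>

section \<open>Change of variables for nonnegative functions\<close>

text \<open>A priori \<open>C\<close> may be infinite, so the comparison of exponents cannot be run
  on the whole manifold. Properness makes every \<open>D_r\<close> compact, hence all integrals over
  it finite, and the volume of \<open>D_r\<close> is bounded by \<open>J(1)\<close> over that same
  set. Fed back into \<open>J(1)\<close>, this bounds the contribution of a far shell by a small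
  multiple of the quantity being estimated, which is then absorbed. At \<epsilon> = 0 the quadratic
  terms of the shell estimate balance exactly, and the derivative in \<epsilon> of their sum is
  \<open>a2 - \<beta> / 4\<close>; hence the condition on \<open>a2\<close>.

  In the variable \<open>x = - ln u\<close> the differential inequality bounds the exponential
  growth rate of \<open>J\<close> by \<open>\<alpha> * P / \<beta>\<close>. It is integrated in
  discrete steps, so \<open>J\<close> is never differentiated and \<open>P\<close> may have either
  sign.

  \<open>laplacian\<close> evaluates its coordinate formula in a chart chosen arbitrarily at each
  point, so even continuity of \<Delta>h presupposes chart independence, which must be settled
  before Green's formula is globalized. Test functions enter only through first derivatives, so C1
  cutoffs suffice throughout.\<close>

lemma absolutely_integrable_iff_nn_integral_finite:
  fixes f :: "'a::euclidean_space \<Rightarrow> real"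
  assumes "set_borel_measurable borel S f" "\<And>x. x \<in> S \<Longrightarrow> 0 \<le> f x"
  shows "f absolutely_integrable_on S \<longleftrightarrow> (\<integral>\<^sup>+x\<in>S. ennreal (f x) \<partial>lborel) < \<infinity>"
    and "f absolutely_integrable_on S \<Longrightarrow>
      (\<integral>\<^sup>+x\<in>S. ennreal (f x) \<partial>lborel) = ennreal (integral S f)"
proof -
  have m: "(\<lambda>x. indicat_real S x * f x) \<in> borel_measurable lborel"
    using assms(1) by (simp add: set_borel_measurable_def)
  have eq: "(\<integral>\<^sup>+x\<in>S. ennreal (f x) \<partial>lborel) = (\<integral>\<^sup>+x. ennreal (indicat_real S x * f x) \<partial>lborel)"
    by (intro nn_integral_cong) (auto simp: indicator_def)
  have nn: "0 \<le> indicat_real S x * f x" for x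
    using assms(2) by (auto simp: indicator_def)
  have iff: "f absolutely_integrable_on S \<longleftrightarrow> integrable lborel (\<lambda>x. indicat_real S x * f x)"
    using m by (simp add: set_integrable_def integrable_completion)
  show "f absolutely_integrable_on S \<longleftrightarrow> (\<integral>\<^sup>+x\<in>S. ennreal (f x) \<partial>lborel) < \<infinity>"
    unfolding iff eq integrable_iff_bounded using m nn by simp
  assume ai: "f absolutely_integrable_on S"
  have "(\<integral>\<^sup>+x\<in>S. ennreal (f x) \<partial>lborel) = ennreal (integral\<^sup>L lborel (\<lambda>x. indicat_real S x * f x))"
    unfolding eq using ai iff nn by (intro nn_integral_eq_integral) auto
  also have "integral\<^sup>L lborel (\<lambda>x. indicat_real S x * f x) = integral S f"
    using set_lebesgue_integral_eq_integral(2)[OF ai] m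
    by (simp add: set_lebesgue_integral_def integral_completion)
  finally show "(\<integral>\<^sup>+x\<in>S. ennreal (f x) \<partial>lborel) = ennreal (integral S f)" .
qed

text \<open>For nonnegative integrands absolute integrability is finiteness of the nonnegative
  integral. Since the absolutely integrable theorem is an equivalence, the two sides are either
  finite and equal or both infinite.\<close>

lemma nn_integral_change_of_variables_wellorder:
  fixes T :: "real^'m::{finite,wellorder} \<Rightarrow> real^'m::_" and f :: "real^'m::_ \<Rightarrow> real"
  assumes S: "S \<in> sets borel"
    and der: "\<And>x. x \<in> S \<Longrightarrow> (T has_derivative T' x) (at x within S)"
    and inj: "inj_on T S"
    and f: "set_borel_measurable borel (T ` S) f" "\<And>x. x \<in> T ` S \<Longrightarrow> 0 \<le> f x"
    and fT: "set_borel_measurable borel S (\<lambda>x. \<bar>det (matrix (T' x))\<bar> * f (T x))"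
  shows "(\<integral>\<^sup>+x\<in>T ` S. ennreal (f x) \<partial>lborel) =
    (\<integral>\<^sup>+x\<in>S. ennreal (\<bar>det (matrix (T' x))\<bar> * f (T x)) \<partial>lborel)"
proof -
  let ?D = "\<lambda>x. \<bar>det (matrix (T' x))\<bar> * f (T x)"
  have SL: "S \<in> sets lebesgue" using S by auto
  have vec: "(\<lambda>x. \<bar>det (matrix (T' x))\<bar> *\<^sub>R (vec (f (T x)) :: real^1)) = (\<lambda>x. vec (?D x))"
    by (auto simp: vec_eq_iff)
  \<comment> \<open>The value \<open>b\<close> stays free: taking for it the integral of one side or
    of the other transfers integrability in both directions.\<close>
  have key: "?D absolutely_integrable_on S \<and> integral S ?D = b \<longleftrightarrow>
     f absolutely_integrable_on (T ` S) \<and> integral (T ` S) f = b" for b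
    using has_absolute_integral_change_of_variables[OF SL der inj, of "\<lambda>x. vec (f x) :: real^1" "vec b"]
    by (simp add: vec absolutely_integrable_on_1_iff integral_on_1_eq)
  have nn: "\<And>x. x \<in> S \<Longrightarrow> 0 \<le> ?D x" using f(2) by simp
  have A: "f absolutely_integrable_on T ` S \<longleftrightarrow> (\<integral>\<^sup>+x\<in>T ` S. ennreal (f x) \<partial>lborel) < \<infinity>"
    "f absolutely_integrable_on T ` S \<Longrightarrow>
      (\<integral>\<^sup>+x\<in>T ` S. ennreal (f x) \<partial>lborel) = ennreal (integral (T ` S) f)"
    by (rule absolutely_integrable_iff_nn_integral_finite[OF f]; assumption)+
  have B: "?D absolutely_integrable_on S \<longleftrightarrow> (\<integral>\<^sup>+x\<in>S. ennreal (?D x) \<partial>lborel) < \<infinity>"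
    "?D absolutely_integrable_on S \<Longrightarrow>
      (\<integral>\<^sup>+x\<in>S. ennreal (?D x) \<partial>lborel) = ennreal (integral S ?D)"
    by (rule absolutely_integrable_iff_nn_integral_finite[OF fT nn]; assumption)+
  show ?thesis
  proof (cases "f absolutely_integrable_on (T ` S)")
    case True
    then have "?D absolutely_integrable_on S" "integral S ?D = integral (T ` S) f"
      using key[of "integral (T ` S) f"] by blast+
    then show ?thesis by (simp only: A(2)[OF True] B(2))
  next
    case False
    then have "\<not> ?D absolutely_integrable_on S" using key[of "integral S ?D"] by blast
    then show ?thesis using False unfolding A(1) B(1) by (simp only: infinity_ennreal_def not_less top.extremum_unique)
  qed
qed

text \<open>
  The change of variables theorem of the library needs coordinates indexed by a well-ordered type,
  so an arbitrary finite index type is replaced by a well-ordered copy of itself.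
\<close>

typedef 'n wellordered = "UNIV :: 'n set" by simp

lemma bij_Rep_wellordered: "bij Rep_wellordered"
  using type_definition.Rep_range[OF type_definition_wellordered]
  by (simp add: bij_def inj_def Rep_wellordered_inject)

instance wellordered :: (finite) finite
proof
  have "finite (range (Abs_wellordered :: 'a \<Rightarrow> _))" by (rule finite_imageI) simp
  then show "finite (UNIV :: 'a wellordered set)"
    by (simp only: type_definition.Abs_image[OF type_definition_wellordered])
qed

text \<open>Any injection will do: determinants and Lebesgue measure do not see how the coordinates
  are ordered.\<close>

definition wellordered_index :: "'n::finite wellordered \<Rightarrow> nat" where
  "wellordered_index = (SOME f. inj f)"

lemma inj_wellordered_index: "inj wellordered_index"
  unfolding wellordered_index_def
  by (rule someI[of inj "to_nat_on UNIV"], rule inj_on_to_nat_on) (simp add: countable_finite)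

instantiation wellordered :: (finite) wellorder
begin

definition less_eq_wellordered :: "'a wellordered \<Rightarrow> 'a wellordered \<Rightarrow> bool" where
  "less_eq_wellordered x y \<longleftrightarrow> wellordered_index x \<le> wellordered_index y"

definition less_wellordered :: "'a wellordered \<Rightarrow> 'a wellordered \<Rightarrow> bool" where
  "less_wellordered x y \<longleftrightarrow> wellordered_index x < wellordered_index y"

instance
proof
  fix x y z :: "'a wellordered"
  show "x < y \<longleftrightarrow> x \<le> y \<and> \<not> y \<le> x" "x \<le> x" "x \<le> y \<or> y \<le> x"
    unfolding less_eq_wellordered_def less_wellordered_def by linarith+
  show "x \<le> z" if "x \<le> y" "y \<le> z"
    using that unfolding less_eq_wellordered_def by linarith
  show "x = y" if "x \<le> y" "y \<le> x"
    using that inj_wellordered_index unfolding less_eq_wellordered_def inj_def by (meson le_antisym)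
next
  fix P :: "'a wellordered \<Rightarrow> bool" and a
  assume step: "\<And>x. (\<And>y. y < x \<Longrightarrow> P y) \<Longrightarrow> P x"
  show "P a"
  proof (induction "wellordered_index a" arbitrary: a rule: less_induct)
    case less
    show ?case
      by (rule step, rule less) (simp only: less_wellordered_def)
  qed
qed

end

section \<open>Relabelling coordinates: determinants and Lebesgue measure\<close>

lemma bij_betw_map_permutation:
  assumes f: "bij (f :: 'm \<Rightarrow> 'n)"
  shows "bij_betw (map_permutation UNIV f) {p. p permutes UNIV} {q. q permutes UNIV}"
proof (rule bij_betw_byWitness[where f' = "\<lambda>q. inv f \<circ> q \<circ> f"])
  have mp: "map_permutation UNIV f p = f \<circ> p \<circ> inv f" for p
    using f by (simp add: map_permutation_def bij_is_surj restrict_id_def fun_eq_iff)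
  show "\<forall>p\<in>{p. p permutes UNIV}. inv f \<circ> map_permutation UNIV f p \<circ> f = p"
    using f by (simp add: mp fun_eq_iff bij_is_inj)
  show "\<forall>q\<in>{q. q permutes UNIV}. map_permutation UNIV f (inv f \<circ> q \<circ> f) = q"
    using f by (simp add: mp fun_eq_iff bij_is_surj surj_f_inv_f)
  show "map_permutation UNIV f ` {p. p permutes UNIV} \<subseteq> {q. q permutes UNIV}"
    using map_permutation_permutes[OF f] by blast
  show "(\<lambda>q. inv f \<circ> q \<circ> f) ` {q. q permutes UNIV} \<subseteq> {p. p permutes UNIV}"
    using f by (auto intro!: bij_comp bij_imp_bij_inv bij_imp_permutes dest: permutes_bij)
qed

text \<open>In the Leibniz formula a simultaneous relabelling of rows and columns conjugates the
  permutations, which preserves their signs.\<close>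

lemma det_reindex:
  fixes A :: "real^'n::finite^'n" and f :: "'m::finite \<Rightarrow> 'n"
  assumes f: "bij f"
  shows "det (\<chi> i j. A $ f i $ f j) = det A"
proof -
  have inj: "inj_on f UNIV" using f bij_is_inj by auto
  let ?term = "\<lambda>q. of_int (sign q) * (\<Prod>i\<in>UNIV. A $ i $ q i)"
  have eq: "?term (map_permutation UNIV f p) = of_int (sign p) * (\<Prod>i\<in>UNIV. A $ f i $ f (p i))"
    if p: "p permutes UNIV" for p
  proof -
    have "map_permutation UNIV f p (f i) = f (p i)" for i
      using inj by (simp add: map_permutation_apply)
    then have "(\<Prod>i\<in>UNIV. A $ i $ map_permutation UNIV f p i) = (\<Prod>i\<in>UNIV. A $ f i $ f (p i))"
      using prod.reindex_bij_betw[OF f, of "\<lambda>i. A $ i $ map_permutation UNIV f p i"] by simp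
    moreover have "sign (map_permutation UNIV f p) = sign p"
      by (rule sign_map_permutation[OF inj p]) simp
    ultimately show ?thesis by simp
  qed
  have "det (\<chi> i j. A $ f i $ f j) =
      (\<Sum>p\<in>{p. p permutes UNIV}. of_int (sign p) * (\<Prod>i\<in>UNIV. A $ f i $ f (p i)))"
    by (simp add: det_def)
  also have "\<dots> = (\<Sum>p\<in>{p. p permutes UNIV}. ?term (map_permutation UNIV f p))"
    by (rule sum.cong[OF refl], rule eq[symmetric]) simp
  also have "\<dots> = (\<Sum>q\<in>{q. q permutes UNIV}. ?term q)"
    by (rule sum.reindex_bij_betw[OF bij_betw_map_permutation[OF f], of ?term])
  also have "\<dots> = det A"
    by (simp add: det_def)
  finally show ?thesis .
qed

definition reindex :: "('m \<Rightarrow> 'n) \<Rightarrow> real^'n::finite \<Rightarrow> real^'m::finite" where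
  "reindex f x = (\<chi> i. x $ f i)"

lemma bounded_linear_reindex: "bounded_linear (reindex f)"
  unfolding reindex_def
  by (auto simp: linear_conv_bounded_linear[symmetric] linear_iff vec_eq_iff)

lemma measurable_reindex [measurable]: "reindex f \<in> borel_measurable borel"
  by (intro borel_measurable_continuous_onI linear_continuous_on bounded_linear_reindex)

lemma reindex_inverse:
  assumes "bij f"
  shows "reindex f (reindex (inv f) x) = x" "reindex (inv f) (reindex f y) = y"
  using assms by (auto simp: reindex_def vec_eq_iff bij_is_inj bij_is_surj surj_f_inv_f)

lemma prod_Basis_cart:
  fixes z :: "real^'n::finite"
  shows "(\<Prod>b\<in>Basis. z \<bullet> b) = (\<Prod>i\<in>UNIV. z $ i)"
proof -
  have B: "(Basis :: (real^'n) set) = (\<lambda>i. axis i 1) ` UNIV" by (auto simp: Basis_vec_def)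
  have "inj (\<lambda>i::'n. axis i (1::real))" by (auto simp: inj_on_def axis_eq_axis)
  then show ?thesis unfolding B by (subst prod.reindex) (auto simp: inner_axis)
qed

text \<open>Lebesgue measure is determined by its values on boxes, and the preimage of a box is a
  box with the same side lengths in another order.\<close>

lemma lborel_distr_reindex:
  fixes f :: "'m::finite \<Rightarrow> 'n::finite"
  assumes f: "bij f"
  shows "distr lborel borel (reindex f) = lborel"
proof (rule lborel_eqI[symmetric])
  fix l u :: "real^'m" assume le: "\<And>b. b \<in> Basis \<Longrightarrow> l \<bullet> b \<le> u \<bullet> b"
  have le': "l $ i \<le> u $ i" for i using le[of "axis i 1"] by (simp add: inner_axis axis_in_Basis_iff)
  let ?l = "reindex (inv f) l" and ?u = "reindex (inv f) u"
  have "x \<in> reindex f -` box l u \<longleftrightarrow> x \<in> box ?l ?u" for x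
    unfolding mem_box_cart vimage_eq
    by (simp add: reindex_def) (metis f bij_is_inj bij_is_surj inv_f_f surj_f_inv_f)
  then have v: "reindex f -` box l u = box ?l ?u" by blast
  have "emeasure (distr lborel borel (reindex f)) (box l u) = emeasure lborel (box ?l ?u)"
    by (subst emeasure_distr) (auto simp: v)
  also have "\<dots> = (\<Prod>b\<in>Basis. (?u - ?l) \<bullet> b)"
    using le' by (subst emeasure_lborel_box) (auto simp: Basis_vec_def inner_axis reindex_def)
  also have "\<dots> = ennreal (\<Prod>i\<in>UNIV. u $ inv f i - l $ inv f i)"
    unfolding prod_Basis_cart by (simp add: reindex_def)
  also have "\<dots> = ennreal (\<Prod>i\<in>UNIV. u $ i - l $ i)"
    using prod.reindex_bij_betw[of "inv f" UNIV UNIV "\<lambda>i. u $ i - l $ i"] bij_imp_bij_inv[OF f]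
    by simp
  finally show "emeasure (distr lborel borel (reindex f)) (box l u) = (\<Prod>b\<in>Basis. (u - l) \<bullet> b)"
    unfolding prod_Basis_cart by simp
qed simp

lemma nn_integral_reindex:
  fixes f :: "'m::finite \<Rightarrow> 'n::finite"
  assumes f: "bij f" and g: "set_borel_measurable borel S g"
  shows "(\<integral>\<^sup>+x\<in>reindex f ` S. ennreal (g (reindex (inv f) x)) \<partial>lborel) = (\<integral>\<^sup>+x\<in>S. ennreal (g x) \<partial>lborel)"
proof -
  have f': "bij (inv f)" using bij_imp_bij_inv[OF f] .
  have "(\<lambda>x. ennreal (indicat_real S x * g x)) \<in> borel_measurable borel"
    using g by (simp add: set_borel_measurable_def)
  moreover have "(\<lambda>x. ennreal (indicat_real S x * g x)) = (\<lambda>x. ennreal (g x) * indicator S x)"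
    by (auto simp: indicator_def fun_eq_iff)
  ultimately have m: "(\<lambda>x. ennreal (g x) * indicator S x) \<in> borel_measurable borel" by simp
  have "(\<integral>\<^sup>+x\<in>S. ennreal (g x) \<partial>lborel)
      = (\<integral>\<^sup>+x. ennreal (g x) * indicator S x \<partial>distr lborel borel (reindex (inv f)))"
    by (simp add: lborel_distr_reindex[OF f'])
  also have "\<dots> = (\<integral>\<^sup>+x\<in>reindex f ` S. ennreal (g (reindex (inv f) x)) \<partial>lborel)"
    by (subst nn_integral_distr)
      (use m in \<open>auto intro!: nn_integral_cong simp: indicator_def reindex_inverse[OF f] image_iff\<close>,
        metis f reindex_inverse(1))
  finally show ?thesis by simp
qed

text \<open>Conjugating \<open>T\<close> by \<open>reindex\<close> moves it to coordinates with a
  well-ordered index type. Neither the integrals nor the Jacobian determinant change.\<close>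

theorem nn_integral_change_of_variables:
  fixes T :: "real^'n::finite \<Rightarrow> real^'n" and f :: "real^'n \<Rightarrow> real"
  assumes S: "S \<in> sets borel"
    and der: "\<And>x. x \<in> S \<Longrightarrow> (T has_derivative T' x) (at x within S)"
    and inj: "inj_on T S"
    and f: "set_borel_measurable borel (T ` S) f" "\<And>x. x \<in> T ` S \<Longrightarrow> 0 \<le> f x"
    and fT: "set_borel_measurable borel S (\<lambda>x. \<bar>det (matrix (T' x))\<bar> * f (T x))"
  shows "(\<integral>\<^sup>+x\<in>T ` S. ennreal (f x) \<partial>lborel) =
    (\<integral>\<^sup>+x\<in>S. ennreal (\<bar>det (matrix (T' x))\<bar> * f (T x)) \<partial>lborel)"
proof -
  let ?\<rho> = "Rep_wellordered :: 'n wellordered \<Rightarrow> 'n"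
  have \<rho>: "bij ?\<rho>" by (rule bij_Rep_wellordered)
  let ?R = "reindex ?\<rho>" and ?R' = "reindex (inv ?\<rho>)"
  note inv = reindex_inverse[OF \<rho>]
  have bl: "bounded_linear ?R" "bounded_linear ?R'" by (rule bounded_linear_reindex)+
  let ?U = "?R \<circ> T \<circ> ?R'" and ?U' = "\<lambda>y. ?R \<circ> T' (?R' y) \<circ> ?R'"
  have im: "?R ` S = ?R' -` S" using inv by (auto simp: image_iff) metis
  have imT: "?R ` (T ` S) = ?U ` (?R ` S)" using inv by (auto simp: image_iff)
  have im2: "?R ` A = ?R' -` A" for A using inv by (auto simp: image_iff) metis
  have meas: "set_borel_measurable borel (?R ` A) (\<lambda>x. k (?R' x))" if "set_borel_measurable borel A k"
    for A k
    using measurable_compose[OF measurable_reindex that[unfolded set_borel_measurable_def], of "inv ?\<rho>"]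
    unfolding set_borel_measurable_def im2 by (simp add: indicator_def)
  have det: "det (matrix (?U' (?R x))) = det (matrix (T' x))" if "x \<in> S" for x
  proof -
    have lin: "linear (T' x)" using der[OF that] has_derivative_linear by blast
    have "matrix (?U' (?R x)) = (\<chi> i j. matrix (T' x) $ ?\<rho> i $ ?\<rho> j)"
    proof -
      have "?R' (axis j 1) = axis (?\<rho> j) 1" for j
        using \<rho> by (auto simp: reindex_def vec_eq_iff axis_def bij_is_surj surj_f_inv_f bij_is_inj)
      then show ?thesis by (simp add: matrix_def inv) (simp add: reindex_def)
    qed
    then show ?thesis using det_reindex[OF \<rho>, of "matrix (T' x)"] by simp
  qed
  have "(\<integral>\<^sup>+x\<in>T ` S. ennreal (f x) \<partial>lborel) =
     (\<integral>\<^sup>+x\<in>?U ` (?R ` S). ennreal (f (?R' x)) \<partial>lborel)"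
    using nn_integral_reindex[OF \<rho> f(1)] imT by simp
  also have "\<dots> = (\<integral>\<^sup>+x\<in>?R ` S. ennreal (\<bar>det (matrix (?U' x))\<bar> * f (?R' (?U x))) \<partial>lborel)"
  proof (rule nn_integral_change_of_variables_wellorder)
    show "?R ` S \<in> sets borel"
      unfolding im using S measurable_sets[OF measurable_reindex, of S "inv ?\<rho>"] by simp
    show "(?U has_derivative ?U' y) (at y within ?R ` S)" if "y \<in> ?R ` S" for y
    proof -
      have "?R' y \<in> S" using that im by blast
      moreover have im': "?R' ` (?R ` S) = S" using inv by (auto simp: image_iff)
      ultimately have "(T has_derivative T' (?R' y)) (at (?R' y) within ?R' ` (?R ` S))" using der by simp
      from diff_chain_within[OF bounded_linear_imp_has_derivative[OF bl(2)] this]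
      have "((T \<circ> ?R') has_derivative (T' (?R' y) \<circ> ?R')) (at y within ?R ` S)" .
      from diff_chain_within[OF this bounded_linear_imp_has_derivative[OF bl(1)]]
      show ?thesis by (simp add: comp_assoc)
    qed
    show "inj_on ?U (?R ` S)"
      using inj inv unfolding inj_on_def by (auto, metis)
    show "set_borel_measurable borel (?U ` (?R ` S)) (\<lambda>x. f (?R' x))"
      using meas[OF f(1)] imT by simp
    show "0 \<le> f (?R' x)" if "x \<in> ?U ` (?R ` S)" for x
      using that f(2) inv by auto
    have "set_borel_measurable borel (?R ` S) (\<lambda>x. \<bar>det (matrix (T' (?R' x)))\<bar> * f (T (?R' x)))"
      using meas[OF fT] .
    then show "set_borel_measurable borel (?R ` S) (\<lambda>x. \<bar>det (matrix (?U' x))\<bar> * f (?R' (?U x)))"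
      unfolding set_borel_measurable_def
      by (rule measurable_cong[THEN iffD1, rotated]) (auto simp: indicator_def inv det[unfolded inv])
  qed
  also have "\<dots> = (\<integral>\<^sup>+x\<in>?R ` S. ennreal (\<bar>det (matrix (T' (?R' x)))\<bar> * f (T (?R' x))) \<partial>lborel)"
    by (intro nn_integral_cong) (auto simp: indicator_def inv det[unfolded inv])
  also have "\<dots> = (\<integral>\<^sup>+x\<in>S. ennreal (\<bar>det (matrix (T' x))\<bar> * f (T x)) \<partial>lborel)"
    using nn_integral_reindex[OF \<rho> fT] .
  finally show ?thesis .
qed

section \<open>Continuously differentiable real functions on Euclidean space\<close>

definition grad :: "(real^'n::finite \<Rightarrow> real) \<Rightarrow> real^'n \<Rightarrow> real^'n" where
  "grad f x = (\<chi> i. partial i f x)"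

text \<open>Differentiability is required at the points of \<open>S\<close>, not within
  \<open>S\<close>, so the notion passes to subsets. The derivative is tied to the total function
  \<open>grad\<close>, so no witness has to be carried along.\<close>

definition C1_on :: "(real^'n::finite) set \<Rightarrow> (real^'n \<Rightarrow> real) \<Rightarrow> bool" where
  "C1_on S f \<longleftrightarrow> (\<forall>x\<in>S. GDERIV f x :> grad f x) \<and> continuous_on S (grad f)"

lemma GDERIV_imp_grad: "GDERIV f x :> D \<Longrightarrow> grad f x = D"
  by (simp add: gderiv_def grad_def partial_def frechet_derivative_at[symmetric] vec_eq_iff inner_axis')

lemma has_derivative_imp_GDERIV:
  fixes f :: "real^'n::finite \<Rightarrow> real"
  assumes "(f has_derivative f') (at x)"
  shows "GDERIV f x :> (\<chi> i. f' (axis i 1))"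
proof -
  have lin: "linear f'" using assms has_derivative_linear by blast
  have "f' v = v \<bullet> (\<chi> i. f' (axis i 1))" for v
  proof -
    have "f' v = f' (\<Sum>i\<in>UNIV. v $ i *\<^sub>R axis i 1)"
      using basis_expansion[of v] by (simp add: scalar_mult_eq_scaleR)
    also have "\<dots> = (\<Sum>i\<in>UNIV. v $ i * f' (axis i 1))"
      by (simp add: linear_sum[OF lin] linear_scale[OF lin])
    finally show ?thesis by (simp add: inner_vec_def)
  qed
  then have "f' = (\<lambda>v. v \<bullet> (\<chi> i. f' (axis i 1)))" by (rule ext)
  with assms show ?thesis unfolding gderiv_def by (rule has_derivative_eq_rhs)
qed

lemma C1_onI:
  assumes "\<And>x. x \<in> S \<Longrightarrow> GDERIV f x :> G x" "continuous_on S G"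
  shows "C1_on S f"
  using assms GDERIV_imp_grad[OF assms(1)] continuous_on_cong[of S S "grad f" G]
  by (auto simp: C1_on_def)

lemma C1_on_GDERIV: "C1_on S f \<Longrightarrow> x \<in> S \<Longrightarrow> GDERIV f x :> grad f x"
  by (simp add: C1_on_def)

lemma C1_on_continuous_grad: "C1_on S f \<Longrightarrow> continuous_on S (grad f)"
  by (simp add: C1_on_def)

lemma GDERIV_isCont: "GDERIV f x :> D \<Longrightarrow> isCont f x"
  unfolding gderiv_def using has_derivative_continuous by blast

lemma C1_on_continuous: "C1_on S f \<Longrightarrow> continuous_on S f"
  by (meson C1_on_GDERIV GDERIV_isCont continuous_at_imp_continuous_on)

lemma C1_on_subset: "C1_on S f \<Longrightarrow> T \<subseteq> S \<Longrightarrow> C1_on T f"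
  by (auto simp: C1_on_def intro: continuous_on_subset)

lemma GDERIV_transform_open:
  assumes "GDERIV f x :> D" "open S" "x \<in> S" "\<And>y. y \<in> S \<Longrightarrow> f y = g y"
  shows "GDERIV g x :> D"
  using assms(1) unfolding gderiv_def
  by (rule has_derivative_transform_within_open[OF _ assms(2,3,4)])

lemma C1_on_cong:
  assumes "open S" "\<And>x. x \<in> S \<Longrightarrow> f x = g x"
  shows "C1_on S f \<longleftrightarrow> C1_on S g"
proof -
  have "C1_on S g" if "C1_on S f" "\<And>x. x \<in> S \<Longrightarrow> f x = g x" for f g
    by (rule C1_onI[of _ _ "grad f"])
      (use that assms(1) in \<open>auto intro: GDERIV_transform_open C1_on_GDERIV C1_on_continuous_grad\<close>)
  then show ?thesis using assms(2) by metis
qed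

lemma grad_cong:
  assumes "C1_on S f" "open S" "x \<in> S" "\<And>y. y \<in> S \<Longrightarrow> f y = g y"
  shows "grad g x = grad f x"
  using GDERIV_imp_grad GDERIV_transform_open[OF C1_on_GDERIV[OF assms(1,3)] assms(2-4)] by blast

lemma C1_on_open_Un:
  assumes "open S" "open T" "C1_on S f" "C1_on T f"
  shows "C1_on (S \<union> T) f"
  using assms by (auto simp: C1_on_def intro: continuous_on_open_Un)

lemma C1_on_const [simp]: "C1_on S (\<lambda>x. c)"
  by (rule C1_onI[where G = "\<lambda>x. 0"]) (auto simp: GDERIV_const)

lemma C1_on_add: "C1_on S f \<Longrightarrow> C1_on S g \<Longrightarrow> C1_on S (\<lambda>x. f x + g x)"
  by (rule C1_onI[OF GDERIV_add[OF C1_on_GDERIV C1_on_GDERIV]])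
    (auto intro: continuous_intros C1_on_continuous_grad)

lemma C1_on_mult: "C1_on S f \<Longrightarrow> C1_on S g \<Longrightarrow> C1_on S (\<lambda>x. f x * g x)"
  by (rule C1_onI[OF GDERIV_mult[OF C1_on_GDERIV C1_on_GDERIV]])
    (auto intro!: continuous_intros intro: C1_on_continuous_grad C1_on_continuous)

lemma C1_on_sum: "(\<And>i. i \<in> I \<Longrightarrow> C1_on S (f i)) \<Longrightarrow> C1_on S (\<lambda>x. \<Sum>i\<in>I. f i x)"
  by (induction I rule: infinite_finite_induct) (auto intro: C1_on_add)

lemma C1_on_prod: "(\<And>i. i \<in> I \<Longrightarrow> C1_on S (f i)) \<Longrightarrow> C1_on S (\<lambda>x. \<Prod>i\<in>I. f i x)"
  by (induction I rule: infinite_finite_induct) (auto intro: C1_on_mult)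

lemma C1_on_det:
  assumes "\<And>i j. C1_on S (\<lambda>x. A x $ i $ j)"
  shows "C1_on S (\<lambda>x. det (A x))"
  unfolding det_def by (intro C1_on_sum C1_on_mult C1_on_prod C1_on_const assms)

lemma C1_on_compose_DERIV:
  assumes "C1_on S f" "\<And>x. x \<in> S \<Longrightarrow> DERIV \<phi> (f x) :> \<phi>' (f x)" "continuous_on (f ` S) \<phi>'"
  shows "C1_on S (\<lambda>x. \<phi> (f x))"
    and "x \<in> S \<Longrightarrow> grad (\<lambda>x. \<phi> (f x)) x = \<phi>' (f x) *\<^sub>R grad f x"
proof -
  have G: "GDERIV (\<lambda>x. \<phi> (f x)) x :> \<phi>' (f x) *\<^sub>R grad f x" if "x \<in> S" for x
    by (rule GDERIV_DERIV_compose[OF C1_on_GDERIV[OF assms(1) that] assms(2)[OF that]])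
  then show "x \<in> S \<Longrightarrow> grad (\<lambda>x. \<phi> (f x)) x = \<phi>' (f x) *\<^sub>R grad f x"
    by (rule GDERIV_imp_grad)
  show "C1_on S (\<lambda>x. \<phi> (f x))"
    by (rule C1_onI[OF G])
      (auto intro!: continuous_intros C1_on_continuous_grad assms(1)
        continuous_on_compose2[OF assms(3) C1_on_continuous[OF assms(1)]])
qed

lemma C1_on_divide:
  assumes "C1_on S f" "C1_on S g" "\<And>x. x \<in> S \<Longrightarrow> g x \<noteq> 0"
  shows "C1_on S (\<lambda>x. f x / g x)"
  unfolding divide_inverse
proof (rule C1_on_mult[OF assms(1)], rule C1_on_compose_DERIV(1)[OF assms(2)])
  show "DERIV inverse (g x) :> - (inverse (g x) ^ 2)" if "x \<in> S" for x
    using DERIV_inverse[of "g x"] assms(3)[OF that] by (simp add: numeral_2_eq_2)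
  show "continuous_on (g ` S) (\<lambda>y. - (inverse y)\<^sup>2)"
    using assms(3) by (auto intro!: continuous_intros)
qed

lemma C1_on_sqrt:
  assumes "C1_on S f" "\<And>x. x \<in> S \<Longrightarrow> f x > 0"
  shows "C1_on S (\<lambda>x. sqrt (f x))"
proof (rule C1_on_compose_DERIV(1)[OF assms(1)])
  show "DERIV sqrt (f x) :> inverse (sqrt (f x)) / 2" if "x \<in> S" for x
    using DERIV_real_sqrt[OF assms(2)[OF that]] .
  show "continuous_on (f ` S) (\<lambda>y. inverse (sqrt y) / 2)"
    by (intro continuous_intros) (use assms(2) in force)+
qed

lemma grad_mult:
  "C1_on S f \<Longrightarrow> C1_on S g \<Longrightarrow> x \<in> S \<Longrightarrow>
    grad (\<lambda>x. f x * g x) x = f x *\<^sub>R grad g x + g x *\<^sub>R grad f x"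
  by (rule GDERIV_imp_grad[OF GDERIV_mult]) (auto intro: C1_on_GDERIV)

lemma grad_sum:
  assumes "\<And>i. i \<in> I \<Longrightarrow> C1_on S (f i)" "x \<in> S"
  shows "grad (\<lambda>x. \<Sum>i\<in>I. f i x) x = (\<Sum>i\<in>I. grad (f i) x)"
proof -
  have "GDERIV (\<lambda>x. \<Sum>i\<in>I. f i x) x :> (\<Sum>i\<in>I. grad (f i) x)"
    using assms(1)
    by (induction I rule: infinite_finite_induct)
      (auto intro!: GDERIV_add GDERIV_const C1_on_GDERIV[OF _ assms(2)])
  then show ?thesis by (rule GDERIV_imp_grad)
qed

lemma grad_const [simp]: "grad (\<lambda>x. c) x = 0"
  by (rule GDERIV_imp_grad) (rule GDERIV_const)

definition jac :: "(real^'n::finite \<Rightarrow> real^'n) \<Rightarrow> real^'n \<Rightarrow> real^'n^'n" where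
  "jac T x = (\<chi> i. grad (\<lambda>y. T y $ i) x)"

lemma has_derivative_jac:
  assumes "\<And>i. C1_on S (\<lambda>x. T x $ i)" "x \<in> S"
  shows "(T has_derivative (*v) (jac T x)) (at x)"
proof -
  have "((\<lambda>x. T x $ i) has_derivative (\<lambda>v. (jac T x *v v) $ i)) (at x)" for i
    using C1_on_GDERIV[OF assms(1)[of i] assms(2)]
    by (simp add: gderiv_def jac_def matrix_vector_mult_def inner_vec_def mult.commute)
  then show ?thesis
    by (subst has_derivative_componentwise_within)
      (auto simp: Basis_vec_def inner_axis)
qed

lemma C1_on_compose:
  assumes T: "\<And>i. C1_on S (\<lambda>x. T x $ i)" and f: "C1_on U f" and sub: "T ` S \<subseteq> U"
  shows "C1_on S (\<lambda>x. f (T x))"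
    and "x \<in> S \<Longrightarrow> grad (\<lambda>x. f (T x)) x = transpose (jac T x) *v grad f (T x)"
proof -
  have G: "GDERIV (\<lambda>x. f (T x)) x :> transpose (jac T x) *v grad f (T x)" if x: "x \<in> S" for x
  proof -
    have "(f has_derivative (\<lambda>h. h \<bullet> grad f (T x))) (at (T x))"
      using C1_on_GDERIV[OF f, of "T x"] x sub by (auto simp: gderiv_def)
    from has_derivative_compose[OF has_derivative_jac[OF T x] this]
    have "((\<lambda>x. f (T x)) has_derivative (\<lambda>h. (jac T x *v h) \<bullet> grad f (T x))) (at x)" .
    moreover have "(jac T x *v h) \<bullet> grad f (T x) = h \<bullet> (transpose (jac T x) *v grad f (T x))" for h
    proof -
      have "(jac T x *v h) \<bullet> grad f (T x) = (grad f (T x) v* jac T x) \<bullet> h"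
        by (subst dot_lmul_matrix) (rule inner_commute)
      also have "\<dots> = h \<bullet> (transpose (jac T x) *v grad f (T x))"
        unfolding transpose_matrix_vector by (rule inner_commute)
      finally show ?thesis .
    qed
    ultimately show ?thesis unfolding gderiv_def by simp
  qed
  then show "x \<in> S \<Longrightarrow> grad (\<lambda>x. f (T x)) x = transpose (jac T x) *v grad f (T x)"
    by (rule GDERIV_imp_grad)
  have cT: "continuous_on S T"
    using has_derivative_jac[OF T] has_derivative_continuous continuous_at_imp_continuous_on by blast
  have "continuous_on S (\<lambda>x. grad f (T x))"
    by (rule continuous_on_compose2[OF C1_on_continuous_grad[OF f] cT sub])
  moreover have "continuous_on S (jac T)"
    unfolding jac_def using C1_on_continuous_grad[OF T] by (rule continuous_on_vec_lambda)
  ultimately have "continuous_on S (\<lambda>x. transpose (jac T x) *v grad f (T x))"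
    by (auto simp: matrix_vector_mult_def transpose_def intro!: continuous_intros)
  with G show "C1_on S (\<lambda>x. f (T x))" by (rule C1_onI)
qed

text \<open>The bridge from \<open>Ck_on\<close>. The map \<open>L\<close> will extract a component
  of a transition map or an entry of the metric, so that all later calculus concerns real
  functions.\<close>

lemma C1_on_bounded_linear:
  fixes f :: "real^'n::finite \<Rightarrow> 'f::real_normed_vector"
  assumes "open S" "Ck_on (Suc k) f S" "bounded_linear L"
  shows "C1_on S (\<lambda>x. L (f x))"
proof (rule C1_onI)
  fix x assume x: "x \<in> S"
  have "f differentiable (at x)"
    using assms(1,2) x by (auto simp: differentiable_on_eq_differentiable_at)
  then have "(f has_derivative frechet_derivative f (at x)) (at x)"
    by (simp add: frechet_derivative_works)
  then have "((\<lambda>x. L (f x)) has_derivative (\<lambda>v. L (frechet_derivative f (at x) v))) (at x)"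
    by (rule bounded_linear.has_derivative[OF assms(3)])
  then show "GDERIV (\<lambda>x. L (f x)) x :> (\<chi> i. L (frechet_derivative f (at x) (axis i 1)))"
    by (rule has_derivative_imp_GDERIV)
next
  have "continuous_on S (\<lambda>x. frechet_derivative f (at x) v)" for v
  proof (cases k)
    case 0 then show ?thesis using assms(2) by auto
  next
    case (Suc m)
    then have "(\<lambda>x. frechet_derivative f (at x) v) differentiable_on S" using assms(2) by simp
    then show ?thesis by (rule differentiable_imp_continuous_on)
  qed
  then show "continuous_on S (\<lambda>x. \<chi> i. L (frechet_derivative f (at x) (axis i 1)))"
    by (intro continuous_on_vec_lambda bounded_linear.continuous_on[OF assms(3)])
qed

lemma Ck_on_Suc_C1_on: "open S \<Longrightarrow> Ck_on (Suc k) f S \<Longrightarrow> C1_on S f"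
  using C1_on_bounded_linear[of S k f "\<lambda>x. x"] by (simp add: bounded_linear_ident)

lemma Ck_on_2_C1_on_partial: "open S \<Longrightarrow> Ck_on 2 f S \<Longrightarrow> C1_on S (\<lambda>x. grad f x $ i)"
  using Ck_on_Suc_C1_on[of S 0 "\<lambda>x. partial i f x"]
  by (simp add: grad_def numeral_2_eq_2 partial_def)

text \<open>The open sets \<open>U\<close> and \<open>- K\<close> cover the space; the extension
  agrees with \<open>f\<close> on the first and with 0 on the second.\<close>

lemma C1_on_extend_zero:
  assumes "open U" "C1_on U f" "compact K" "K \<subseteq> U" "\<And>x. x \<in> U - K \<Longrightarrow> f x = 0"
  shows "C1_on UNIV (\<lambda>x. if x \<in> U then f x else 0)"
    and "grad (\<lambda>x. if x \<in> U then f x else 0) x = (if x \<in> U then grad f x else 0)"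
proof -
  let ?f = "\<lambda>x. if x \<in> U then f x else 0"
  have o: "open (- K)" using assms(3) compact_imp_closed by blast
  have 1: "C1_on U ?f" using assms(2) C1_on_cong[OF assms(1), of f ?f] by simp
  have z: "0 = ?f x" if "x \<in> - K" for x using that assms(5)[of x] by auto
  have 2: "C1_on (- K) ?f"
    using C1_on_cong[OF o, of "\<lambda>x. 0" ?f] z C1_on_const by blast
  have "C1_on (U \<union> - K) ?f"
    by (rule C1_on_open_Un[OF assms(1) o 1 2])
  moreover have "U \<union> - K = UNIV" using assms(4) by blast
  ultimately show "C1_on UNIV ?f" by simp
  have g0: "grad ?f x = 0" if "x \<notin> K" for x
    using grad_cong[OF C1_on_const o, of x 0 ?f] that z by auto
  show "grad ?f x = (if x \<in> U then grad f x else 0)"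
    using grad_cong[OF assms(2,1), of x ?f] g0[of x] assms(4) by auto
qed

lemma C1_on_sqdist:
  fixes a :: "real^'n::finite"
  shows "C1_on S (\<lambda>x. (norm (x - a))\<^sup>2)"
proof -
  have "GDERIV (\<lambda>x. (x - a) \<bullet> (x - a)) x :> 2 *\<^sub>R (x - a)" for x :: "real^'n"
    unfolding gderiv_def
    by (auto intro!: derivative_eq_intros simp: inner_commute algebra_simps)
  then show ?thesis
    unfolding power2_norm_eq_inner
    by (rule C1_onI) (intro continuous_intros)
qed

section \<open>The squared positive part\<close>

text \<open>A substitute for the usual smooth function that is flat at 0: its derivative
  \<open>2 * max 0 y\<close> is continuous, which is all that the bump functions and the cutoff
  need.\<close>

definition pos_sq :: "real \<Rightarrow> real" where
  "pos_sq y = (max 0 y)\<^sup>2"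

lemma DERIV_pos_sq: "DERIV pos_sq y :> 2 * max 0 y"
proof -
  consider "y > 0" | "y < 0" | "y = 0" by linarith
  then show ?thesis
  proof cases
    case 1
    have "DERIV (\<lambda>y. y\<^sup>2) y :> 2 * max 0 y"
      using 1 by (auto intro!: derivative_eq_intros)
    then show ?thesis
      by (rule has_field_derivative_transform_within_open[of _ _ _ "{0<..}"])
        (use 1 in \<open>auto simp: pos_sq_def\<close>)
  next
    case 2
    have "DERIV (\<lambda>y. 0) y :> 2 * max 0 y" using 2 by auto
    then show ?thesis
      by (rule has_field_derivative_transform_within_open[of _ _ _ "{..<0}"])
        (use 2 in \<open>auto simp: pos_sq_def\<close>)
  next
    case 3
    have "((\<lambda>h::real. ((max 0 h)\<^sup>2) / h) \<longlongrightarrow> 0) (at 0)"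
    proof (rule Lim_null_comparison)
      show "\<forall>\<^sub>F h in at (0::real). norm ((max 0 h)\<^sup>2 / h) \<le> \<bar>h\<bar>"
        by (rule always_eventually) (auto simp: power2_eq_square max_def)
      show "((\<lambda>h::real. \<bar>h\<bar>) \<longlongrightarrow> 0) (at 0)"
        using tendsto_rabs_zero[OF tendsto_ident_at] .
    qed
    then show ?thesis using 3 by (simp add: DERIV_def pos_sq_def)
  qed
qed

section \<open>Partial derivatives integrate to zero\<close>

lemma integrable_compact_support:
  fixes f :: "'a::euclidean_space \<Rightarrow> real"
  assumes "continuous_on UNIV f" "compact K" "\<And>x. x \<notin> K \<Longrightarrow> f x = 0"
  shows "integrable lborel f"
proof -
  have "integrable lborel (\<lambda>x. indicator K x *\<^sub>R f x)"
    using borel_integrable_compact[OF assms(2) continuous_on_subset[OF assms(1)]]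
    by (simp add: set_integrable_def indicator_def if_distrib)
  moreover have "(\<lambda>x. indicator K x *\<^sub>R f x) = f"
    using assms(3) by (auto simp: indicator_def fun_eq_iff)
  ultimately show ?thesis by simp
qed

lemma bounded_compact_support:
  fixes f :: "'a::euclidean_space \<Rightarrow> real"
  assumes "continuous_on UNIV f" "compact K" "\<And>x. x \<notin> K \<Longrightarrow> f x = 0"
  obtains M where "0 \<le> M" "\<And>x. \<bar>f x\<bar> \<le> M"
proof -
  have "bounded (f ` K)"
    by (intro compact_imp_bounded compact_continuous_image continuous_on_subset[OF assms(1)] assms(2)) simp
  then obtain M where M: "\<And>x. x \<in> K \<Longrightarrow> \<bar>f x\<bar> \<le> M" by (auto simp: bounded_iff)
  have "\<bar>f x\<bar> \<le> max 0 M" for x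
    using M[of x] assms(3)[of x] by (cases "x \<in> K") auto
  then show thesis using that[of "max 0 M"] by simp
qed

lemma integral_translation:
  fixes f :: "'a::euclidean_space \<Rightarrow> real"
  assumes "f \<in> borel_measurable borel"
  shows "(\<integral>x. f (c + x) \<partial>lborel) = (\<integral>x. f x \<partial>lborel)"
    and "integrable lborel f \<Longrightarrow> integrable lborel (\<lambda>x. f (c + x))"
proof -
  have "(\<integral>x. f x \<partial>distr lborel borel ((+) c)) = (\<integral>x. f (c + x) \<partial>lborel)"
    using assms by (subst integral_distr) auto
  then show "(\<integral>x. f (c + x) \<partial>lborel) = (\<integral>x. f x \<partial>lborel)"
    by (simp add: lborel_distr_plus)
  have "integrable (distr lborel borel ((+) c)) f \<longleftrightarrow> integrable lborel (\<lambda>x. f (c + x))"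
    using assms by (subst integrable_distr_eq) auto
  then show "integrable lborel f \<Longrightarrow> integrable lborel (\<lambda>x. f (c + x))"
    by (simp add: lborel_distr_plus)
qed

text \<open>Difference quotients of \<open>f\<close> integrate to zero because Lebesgue measure is
  translation invariant. They converge to the partial derivative, and dominated convergence passes
  to the limit.\<close>

lemma integral_partial_eq_0:
  fixes f :: "real^'n::finite \<Rightarrow> real"
  assumes f: "C1_on UNIV f" and K: "compact K" and f0: "\<And>x. x \<notin> K \<Longrightarrow> f x = 0"
  shows "integrable lborel (\<lambda>x. grad f x $ i)" "(\<integral>x. grad f x $ i \<partial>lborel) = 0"
proof -
  obtain a where a: "\<And>x. x \<in> K \<Longrightarrow> norm x \<le> a"
    using compact_imp_bounded[OF K] by (auto simp: bounded_iff)
  let ?g = "\<lambda>x. grad f x $ i"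
  have cont: "continuous_on UNIV f" "continuous_on UNIV ?g"
    using C1_on_continuous[OF f] C1_on_continuous_grad[OF f] by (auto intro: continuous_intros)
  have g0: "?g x = 0" if "x \<notin> K" for x
    using grad_cong[OF C1_on_const open_Compl[OF compact_imp_closed[OF K]], of x 0 f] f0 that by simp
  show int_g: "integrable lborel ?g"
    by (rule integrable_compact_support[OF cont(2) K g0])
  have int_f: "integrable lborel f"
    by (rule integrable_compact_support[OF cont(1) K f0])
  obtain M where M: "0 \<le> M" "\<And>x. \<bar>?g x\<bar> \<le> M"
    using bounded_compact_support[OF cont(2) K g0] by blast
  define e :: "real^'n" where "e = axis i 1"
  have ne: "norm e = 1" by (simp add: e_def norm_axis_1)
  define t :: "nat \<Rightarrow> real" where "t = (\<lambda>k. 1 / real (Suc k))"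
  have t: "0 < t k" "t k \<le> 1" for k by (auto simp: t_def)
  have der: "((\<lambda>s. f (s *\<^sub>R e + x)) has_real_derivative ?g (s *\<^sub>R e + x)) (at s)" for s x
  proof -
    have "(f has_derivative (\<lambda>h. h \<bullet> grad f (s *\<^sub>R e + x))) (at (s *\<^sub>R e + x))"
      using C1_on_GDERIV[OF f] by (simp add: gderiv_def)
    moreover have "((\<lambda>s. s *\<^sub>R e + x) has_derivative (\<lambda>s. s *\<^sub>R e)) (at s)"
      by (auto intro!: derivative_eq_intros)
    ultimately have "((\<lambda>s. f (s *\<^sub>R e + x)) has_derivative (\<lambda>h. (h *\<^sub>R e) \<bullet> grad f (s *\<^sub>R e + x))) (at s)"
      by (rule has_derivative_compose[rotated])
    then show ?thesis
      by (simp add: has_field_derivative_def e_def inner_axis' mult_commute_abs)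
  qed
  let ?d = "\<lambda>k x. (f (t k *\<^sub>R e + x) - f x) / t k"
  \<comment> \<open>The mean value theorem supplies the constant \<open>M\<close>. The radius
    exceeds that of the support by 1 because the shifts \<open>t k\<close> are at most 1 and
    \<open>e\<close> is a unit vector.\<close>
  have bound: "norm (?d k x) \<le> M * indicator (cball 0 (a + 1)) x" for k x
  proof (cases "x \<in> cball 0 (a + 1)")
    case True
    obtain z where "f (t k *\<^sub>R e + x) - f (0 *\<^sub>R e + x) = (t k - 0) * ?g (z *\<^sub>R e + x)"
      using MVT2[of 0 "t k" "\<lambda>s. f (s *\<^sub>R e + x)" "\<lambda>s. ?g (s *\<^sub>R e + x)"] der t by auto
    then have "?d k x = ?g (z *\<^sub>R e + x)" using t(1)[of k] by simp
    then show ?thesis using True M by simp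
  next
    case False
    then have "norm x > a + 1" by simp
    moreover have "norm x \<le> norm (t k *\<^sub>R e + x) + norm (t k *\<^sub>R e)"
      using norm_triangle_ineq4[of "t k *\<^sub>R e + x" "t k *\<^sub>R e"] by simp
    ultimately have "norm (t k *\<^sub>R e + x) > a" using t[of k] by (simp add: ne)
    then have "t k *\<^sub>R e + x \<notin> K" "x \<notin> K" using a[of "t k *\<^sub>R e + x"] a[of x] \<open>norm x > a + 1\<close> by linarith+
    then show ?thesis using f0 M(1) by simp
  qed
  have lim: "(\<lambda>k. ?d k x) \<longlonglongrightarrow> ?g x" for x
  proof -
    have "((\<lambda>s. (f (s *\<^sub>R e + x) - f x) / s) \<longlongrightarrow> ?g x) (at 0)"
      using der[of x 0] by (simp add: DERIV_def)
    moreover have "filterlim t (at 0) sequentially"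
      unfolding filterlim_at
      using t(1) LIMSEQ_Suc[OF lim_1_over_n] by (auto simp: t_def less_imp_neq[symmetric])
    ultimately show ?thesis by (rule filterlim_compose)
  qed
  have mf: "f \<in> borel_measurable borel" "?g \<in> borel_measurable borel"
    using cont by (auto intro: borel_measurable_continuous_onI)
  have "(\<lambda>k. integral\<^sup>L lborel (?d k)) \<longlonglongrightarrow> integral\<^sup>L lborel ?g"
  proof (rule integral_dominated_convergence[where w = "\<lambda>x. M * indicator (cball 0 (a + 1)) x"])
    show "integrable lborel (\<lambda>x :: real^'n. M * indicator (cball 0 (a + 1)) x)"
      using emeasure_lborel_cball_finite[of "0 :: real^'n" "a + 1"]
      by (intro integrable_mult_right integrable_real_indicator) auto
    show "?d k \<in> borel_measurable lborel" for k using mf by simp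
  qed (use lim bound mf in auto)
  moreover have "integral\<^sup>L lborel (?d k) = 0" for k
    by (simp only: integral_divide_zero integral_translation(1)[OF mf(1)] diff_self div_0
        Bochner_Integration.integral_diff[OF integral_translation(2)[OF mf(1) int_f] int_f])
  ultimately show "integral\<^sup>L lborel ?g = 0"
    by (simp only: LIMSEQ_const_iff)
qed

section \<open>Positive definite matrices\<close>

lemma pos_def_invertible:
  fixes A :: "real^'n::finite^'n"
  assumes "\<And>v. v \<noteq> 0 \<Longrightarrow> v \<bullet> (A *v v) > 0"
  shows "invertible A"
proof -
  have "x = 0" if "A *v x = 0" for x
    using assms[of x] that by (cases "x = 0") auto
  then show ?thesis
    by (simp add: invertible_left_inverse matrix_left_invertible_ker)
qed

text \<open>The segment from the identity to \<open>A\<close> consists of positive definite, hence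
  invertible, matrices, so the determinant cannot change sign along it.\<close>

lemma pos_def_det_pos:
  fixes A :: "real^'n::finite^'n"
  assumes pd: "\<And>v. v \<noteq> 0 \<Longrightarrow> v \<bullet> (A *v v) > 0"
  shows "det A > 0"
proof (rule ccontr)
  let ?B = "\<lambda>s. (1 - s) *\<^sub>R mat 1 + s *\<^sub>R A"
  assume "\<not> det A > 0"
  then have "det (?B 1) \<le> 0" "0 \<le> det (?B 0)" by simp_all
  moreover have "continuous_on {0..1} (\<lambda>s. det (?B s))"
    unfolding det_def by (intro continuous_intros)
  ultimately obtain s where s: "0 \<le> s" "s \<le> 1" "det (?B s) = 0"
    using IVT2'[of "\<lambda>s. det (?B s)" 1 0 0] by auto
  have "v \<bullet> (?B s *v v) > 0" if "v \<noteq> 0" for v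
  proof -
    have "v \<bullet> (?B s *v v) = (1 - s) * (v \<bullet> v) + s * (v \<bullet> (A *v v))"
      by (simp add: matrix_vector_mult_add_rdistrib scaleR_matrix_vector_assoc[symmetric] inner_add_right)
    also have "\<dots> > 0"
    proof (cases "s = 0")
      case False
      then show ?thesis using s pd[OF that] by (intro add_nonneg_pos mult_nonneg_nonneg mult_pos_pos) auto
    qed (use that in simp)
    finally show ?thesis .
  qed
  then have "invertible (?B s)" by (rule pos_def_invertible)
  then show False using s(3) by (simp add: invertible_det_nz)
qed

lemma matrix_inv_mult_cancel:
  fixes A :: "real^'n::finite^'n"
  assumes "invertible A"
  shows "A *v (matrix_inv A *v b) = b" "matrix_inv A *v (A *v b) = b"
proof -
  have "A ** matrix_inv A = mat 1 \<and> matrix_inv A ** A = mat 1"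
    using assms unfolding matrix_inv_def invertible_def by (rule someI_ex)
  then show "A *v (matrix_inv A *v b) = b" "matrix_inv A *v (A *v b) = b"
    by (simp_all add: matrix_vector_mul_assoc)
qed

text \<open>The inverse metric is a well defined form on covectors: when the metric transforms by
  \<open>J\<close>, covectors transform by \<open>transpose J\<close> and their pairing is
  unchanged.\<close>

lemma congruent_form_inverse:
  fixes P Q J :: "real^'n::finite^'n"
  assumes P: "invertible P" and Q: "invertible Q" and PQ: "P = transpose J ** Q ** J"
  shows "(transpose J *v a) \<bullet> (matrix_inv P *v (transpose J *v b)) = a \<bullet> (matrix_inv Q *v b)"
proof -
  \<comment> \<open>Invertibility of \<open>J\<close> is extracted from that of \<open>P\<close>, so
    no inverse of the transition map has to be differentiated.\<close>
  have "det P = det J * det Q * det J" by (simp add: PQ det_mul det_transpose)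
  then have J: "invertible J" "invertible (transpose J)"
    using P by (auto simp: invertible_det_nz det_transpose)
  let ?y = "matrix_inv P *v (transpose J *v b)"
  have "transpose J *v (Q *v (J *v ?y)) = P *v ?y"
    by (simp only: PQ matrix_vector_mul_assoc matrix_mul_assoc)
  also have "\<dots> = transpose J *v b" by (rule matrix_inv_mult_cancel(1)[OF P])
  finally have "Q *v (J *v ?y) = b"
    using matrix_inv_mult_cancel(2)[OF J(2)] by metis
  then have "J *v ?y = matrix_inv Q *v b"
    using matrix_inv_mult_cancel(2)[OF Q] by metis
  moreover have "(transpose J *v a) \<bullet> ?y = a \<bullet> (J *v ?y)"
    unfolding transpose_matrix_vector by (rule dot_lmul_matrix)
  ultimately show ?thesis by simp
qed

section \<open>Charts\<close>

locale riemannian =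
  fixes \<A> :: "('a::{t2_space, second_countable_topology}, 'n::finite) chart set"
    and g :: "('a, 'n) metric"
  assumes riemannian: "riemannian_manifold \<A> g"
begin

lemma smooth: "smooth_atlas \<A>"
  using riemannian by (simp add: riemannian_manifold_def)

lemma chart: "c \<in> \<A> \<Longrightarrow> is_chart c"
  using smooth by (simp add: smooth_atlas_def)

lemma
  assumes "c \<in> \<A>"
  shows open_chart_dom: "open (chart_dom c)" and open_chart_img: "open (chart_img c)"
    and continuous_on_chart_map: "continuous_on (chart_dom c) (chart_map c)"
    and continuous_on_chart_inv: "continuous_on (chart_img c) (chart_inv c)"
    and chart_inv_map: "p \<in> chart_dom c \<Longrightarrow> chart_inv c (chart_map c p) = p"
    and chart_map_inv: "x \<in> chart_img c \<Longrightarrow> chart_map c (chart_inv c x) = x"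
    and chart_inv_in_dom: "x \<in> chart_img c \<Longrightarrow> chart_inv c x \<in> chart_dom c"
  using chart[OF assms] by (auto simp: is_chart_def homeomorphism_def)

lemma chart_exists: "\<exists>c\<in>\<A>. p \<in> chart_dom c"
  using smooth unfolding smooth_atlas_def by blast

lemma chart_at: "chart_at \<A> p \<in> \<A>" "p \<in> chart_dom (chart_at \<A> p)"
  using chart_exists[of p] someI_ex[of "\<lambda>c. c \<in> \<A> \<and> p \<in> chart_dom c"]
  unfolding chart_at_def by blast+

lemma chart_map_image:
  assumes "c \<in> \<A>" "B \<subseteq> chart_dom c"
  shows "chart_map c ` B = chart_inv c -` B \<inter> chart_img c"
  using assms chart_inv_map[OF assms(1)] by (force simp: image_iff)

lemma open_chart_map_image:
  assumes "c \<in> \<A>" "open W" "W \<subseteq> chart_dom c"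
  shows "open (chart_map c ` W)"
  unfolding chart_map_image[OF assms(1,3)]
  using continuous_open_preimage[OF continuous_on_chart_inv[OF assms(1)] open_chart_img[OF assms(1)] assms(2)]
  by (simp add: Int_commute)

lemma borel_chart_map_image:
  assumes "c \<in> \<A>" "B \<in> sets borel" "B \<subseteq> chart_dom c"
  shows "chart_map c ` B \<in> sets borel"
proof -
  have "chart_inv c \<in> borel_measurable (restrict_space borel (chart_img c))"
    by (rule borel_measurable_continuous_on_restrict[OF continuous_on_chart_inv[OF assms(1)]])
  from measurable_sets[OF this assms(2)]
  have "chart_inv c -` B \<inter> chart_img c \<in> sets (restrict_space borel (chart_img c))"
    by (simp add: space_restrict_space)
  then show ?thesis
    unfolding chart_map_image[OF assms(1,3)]
    using open_chart_img[OF assms(1)] by (subst (asm) sets_restrict_space_iff) auto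
qed

lemma C1_on_transition:
  assumes "c \<in> \<A>" "d \<in> \<A>"
  shows "C1_on (chart_map c ` (chart_dom c \<inter> chart_dom d)) (\<lambda>x. transition c d x $ i)"
proof (rule C1_on_bounded_linear[where L = "\<lambda>v. v $ i" and f = "transition c d" and k = 0])
  show "open (chart_map c ` (chart_dom c \<inter> chart_dom d))"
    by (rule open_chart_map_image[OF assms(1) open_Int[OF open_chart_dom open_chart_dom]])
      (use assms in auto)
  show "Ck_on (Suc 0) (transition c d) (chart_map c ` (chart_dom c \<inter> chart_dom d))"
    using smooth assms unfolding smooth_atlas_def smooth_on_def by blast
  show "bounded_linear (\<lambda>v. v $ i)" by (rule bounded_linear_vec_nth)
qed

lemma transition_chart_map:
  "c \<in> \<A> \<Longrightarrow> p \<in> chart_dom c \<Longrightarrow> transition c d (chart_map c p) = chart_map d p"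
  by (simp add: transition_def chart_inv_map)

lemma metric_transform:
  assumes "c \<in> \<A>" "d \<in> \<A>" "p \<in> chart_dom c" "p \<in> chart_dom d"
  defines "J \<equiv> jac (transition c d) (chart_map c p)"
  shows "g c p = transpose J ** g d p ** J"
proof -
  have "chart_map c p \<in> chart_map c ` (chart_dom c \<inter> chart_dom d)" using assms by blast
  from has_derivative_jac[OF C1_on_transition[OF assms(1,2)] this]
  have "(transition c d has_derivative (*v) J) (at (chart_map c p))" by (simp add: J_def)
  then have "jacobian (transition c d) (at (chart_map c p)) = J"
    by (simp add: jacobian_def frechet_derivative_at[symmetric])
  moreover have "let J = jacobian (transition c d) (at (chart_map c p)) in g c p = transpose J ** g d p ** J"
    using riemannian assms(1-4) unfolding riemannian_manifold_def by blast
  ultimately show ?thesis by (simp add: Let_def)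
qed

lemma metric_pos_def:
  assumes "c \<in> \<A>" "p \<in> chart_dom c"
  shows "v \<noteq> 0 \<Longrightarrow> v \<bullet> (g c p *v v) > 0"
  using riemannian assms unfolding riemannian_manifold_def by blast

lemma metric_invertible: "c \<in> \<A> \<Longrightarrow> p \<in> chart_dom c \<Longrightarrow> invertible (g c p)"
  by (rule pos_def_invertible) (rule metric_pos_def)

lemma metric_det_pos: "c \<in> \<A> \<Longrightarrow> p \<in> chart_dom c \<Longrightarrow> det (g c p) > 0"
  by (rule pos_def_det_pos) (rule metric_pos_def)

lemma vol_density_pos: "c \<in> \<A> \<Longrightarrow> p \<in> chart_dom c \<Longrightarrow> vol_density g c p > 0"
  by (simp add: vol_density_def metric_det_pos)

text \<open>Determinants of the tensor law give
  \<open>det (g c p) = (det J)^2 * det (g d p)\<close>.\<close>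

lemma vol_density_transform:
  assumes "c \<in> \<A>" "d \<in> \<A>" "p \<in> chart_dom c" "p \<in> chart_dom d"
  shows "vol_density g c p = \<bar>det (jac (transition c d) (chart_map c p))\<bar> * vol_density g d p"
  unfolding vol_density_def
  by (subst metric_transform[OF assms])
    (simp add: det_mul det_transpose real_sqrt_mult real_sqrt_abs2 mult.assoc mult.left_commute)

lemma C1_on_metric:
  assumes "c \<in> \<A>"
  shows "C1_on (chart_img c) (\<lambda>x. g c (chart_inv c x) $ i $ j)"
proof -
  have "bounded_linear (\<lambda>A :: real^'n^'n. A $ i $ j)"
    by (rule bounded_linear_compose[OF bounded_linear_vec_nth bounded_linear_vec_nth])
  moreover have "Ck_on (Suc 0) (g c \<circ> chart_inv c) (chart_img c)"
    using riemannian assms unfolding riemannian_manifold_def smooth_on_def by blast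
  ultimately show ?thesis
    using C1_on_bounded_linear[OF open_chart_img[OF assms]] by fastforce
qed

lemma C1_on_det_metric: "c \<in> \<A> \<Longrightarrow> C1_on (chart_img c) (\<lambda>x. det (g c (chart_inv c x)))"
  by (rule C1_on_det) (rule C1_on_metric)

lemma C1_on_vol_density: "c \<in> \<A> \<Longrightarrow> C1_on (chart_img c) (\<lambda>x. vol_density g c (chart_inv c x))"
  unfolding vol_density_def
  by (rule C1_on_sqrt[OF C1_on_det_metric]) (auto intro: metric_det_pos chart_inv_in_dom)

section \<open>The volume measure\<close>

text \<open>A measure on the whole type, concentrated on the domain of a chart of the atlas, so that
  the measures of different charts can be compared and summed.\<close>

definition chart_volume :: "('a, 'n) chart \<Rightarrow> 'a measure" where
  "chart_volume c = distr (density (restrict_space lborel (chart_img c))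
     (\<lambda>x. ennreal (vol_density g c (chart_inv c x)))) borel (chart_inv c)"

lemma sets_chart_volume [simp]: "sets (chart_volume c) = sets borel"
  by (simp add: chart_volume_def)

lemma measurable_chart_inv:
  "c \<in> \<A> \<Longrightarrow> chart_inv c \<in> borel_measurable (restrict_space borel (chart_img c))"
  by (rule borel_measurable_continuous_on_restrict[OF continuous_on_chart_inv])

lemma measurable_density:
  "c \<in> \<A> \<Longrightarrow> (\<lambda>x. vol_density g c (chart_inv c x)) \<in> borel_measurable (restrict_space borel (chart_img c))"
  by (rule borel_measurable_continuous_on_restrict[OF C1_on_continuous[OF C1_on_vol_density]])

lemma sets_restrict_lborel: "sets (restrict_space lborel S) = sets (restrict_space borel S)"
  by (rule sets_restrict_space_cong) simp

lemma emeasure_chart_volume: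
  assumes c: "c \<in> \<A>" and B: "B \<in> sets borel" "B \<subseteq> chart_dom c"
  shows "emeasure (chart_volume c) B =
    (\<integral>\<^sup>+x\<in>chart_map c ` B. ennreal (vol_density g c (chart_inv c x)) \<partial>lborel)"
proof -
  let ?R = "restrict_space lborel (chart_img c)"
  have m: "chart_inv c \<in> borel_measurable ?R"
      "(\<lambda>x. ennreal (vol_density g c (chart_inv c x))) \<in> borel_measurable ?R"
    using measurable_chart_inv[OF c] measurable_density[OF c]
    by (simp_all add: measurable_cong_sets[OF sets_restrict_lborel refl])
  have o: "chart_img c \<inter> space lborel \<in> sets lborel" using open_chart_img[OF c] by simp
  have pre: "chart_inv c -` B \<inter> chart_img c = chart_map c ` B"
    using chart_map_image[OF c B(2)] by simp
  have s: "chart_map c ` B \<in> sets ?R"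
    using measurable_sets[OF m(1) B(1)] by (simp add: space_restrict_space pre)
  have "emeasure (chart_volume c) B =
      emeasure (density ?R (\<lambda>x. ennreal (vol_density g c (chart_inv c x)))) (chart_map c ` B)"
    unfolding chart_volume_def using m B
    by (subst emeasure_distr) (auto simp: space_restrict_space pre)
  also have "\<dots> = (\<integral>\<^sup>+x. ennreal (vol_density g c (chart_inv c x)) * indicator (chart_map c ` B) x \<partial>?R)"
    by (rule emeasure_density[OF m(2) s])
  also have "\<dots> = (\<integral>\<^sup>+x\<in>chart_map c ` B. ennreal (vol_density g c (chart_inv c x)) \<partial>lborel)"
    using image_mono[OF B(2), of "chart_map c"]
    by (subst nn_integral_restrict_space[OF o], intro nn_integral_cong) (simp add: indicator_def, blast)
  finally show ?thesis .
qed

text \<open>The Jacobian factor produced by the change of variables is exactly the one relating the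
  two densities. This consistency lets the local prescriptions come from a single measure.\<close>

lemma emeasure_chart_volume_overlap:
  assumes c: "c \<in> \<A>" and d: "d \<in> \<A>"
    and B: "B \<in> sets borel" "B \<subseteq> chart_dom c" "B \<subseteq> chart_dom d"
  shows "emeasure (chart_volume c) B = emeasure (chart_volume d) B"
proof -
  let ?T = "transition c d" and ?S = "chart_map c ` B"
  let ?w = "\<lambda>c x. vol_density g c (chart_inv c x)"
  have S: "?S \<subseteq> chart_map c ` (chart_dom c \<inter> chart_dom d)" using B by blast
  have TS: "?T ` ?S = chart_map d ` B"
    unfolding image_image by (rule image_cong[OF refl transition_chart_map[OF c subsetD[OF B(2)]]])
  have meas: "set_borel_measurable borel (chart_map e ` B) (?w e)" if e: "e \<in> \<A>" "B \<subseteq> chart_dom e" for e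
  proof -
    have "continuous_on (chart_map e ` B) (?w e)"
      using C1_on_continuous[OF C1_on_vol_density[OF e(1)]] image_mono[OF e(2)]
      by (rule continuous_on_subset)
    with borel_chart_map_image[OF e(1) B(1) e(2)]
    have "(\<lambda>x. indicat_real (chart_map e ` B) x *\<^sub>R ?w e x) \<in> borel_measurable borel"
      by (rule borel_measurable_continuous_on_indicator)
    then show ?thesis by (simp add: set_borel_measurable_def)
  qed
  have eq: "?w c x = \<bar>det (jac ?T x)\<bar> * ?w d (?T x)" if x: "x \<in> ?S" for x
  proof -
    obtain p where p: "p \<in> B" "x = chart_map c p" using x by blast
    then have "p \<in> chart_dom c" "p \<in> chart_dom d" using B by auto
    then show ?thesis
      using vol_density_transform[OF c d]
      by (simp add: p(2) chart_inv_map[OF c] chart_inv_map[OF d] transition_chart_map[OF c])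
  qed
  have "(\<integral>\<^sup>+x\<in>?T ` ?S. ennreal (?w d x) \<partial>lborel) =
    (\<integral>\<^sup>+x\<in>?S. ennreal (\<bar>det (matrix ((*v) (jac ?T x)))\<bar> * ?w d (?T x)) \<partial>lborel)"
  proof (rule nn_integral_change_of_variables[where T = ?T and f = "?w d" and T' = "\<lambda>x. (*v) (jac ?T x)"])
    show "?S \<in> sets borel" by (rule borel_chart_map_image[OF c B(1,2)])
    show "(?T has_derivative (*v) (jac ?T x)) (at x within ?S)" if "x \<in> ?S" for x
      by (rule has_derivative_at_withinI[OF has_derivative_jac[OF C1_on_transition[OF c d] subsetD[OF S that]]])
    show "inj_on ?T ?S"
    proof (rule inj_onI)
      fix x y assume "x \<in> ?S" "y \<in> ?S" and eq: "?T x = ?T y"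
      then obtain p q where pq: "p \<in> B" "q \<in> B" "x = chart_map c p" "y = chart_map c q" by blast
      then have "chart_map d p = chart_map d q"
        using eq B(2) transition_chart_map[OF c] by (metis subsetD)
      then show "x = y" using pq B(3) chart_inv_map[OF d] by (metis subsetD)
    qed
    show "set_borel_measurable borel (?T ` ?S) (?w d)"
      unfolding TS by (rule meas[OF d B(3)])
    show "0 \<le> ?w d x" if "x \<in> ?T ` ?S" for x
      using that B(3) vol_density_pos[OF d] chart_inv_map[OF d] unfolding TS by (auto intro!: less_imp_le)
    show "set_borel_measurable borel ?S (\<lambda>x. \<bar>det (matrix ((*v) (jac ?T x)))\<bar> * ?w d (?T x))"
      using meas[OF c B(2)] unfolding set_borel_measurable_def
      by (rule measurable_cong[THEN iffD1, rotated]) (auto simp: indicator_def eq)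
  qed
  also have "\<dots> = (\<integral>\<^sup>+x\<in>?S. ennreal (?w c x) \<partial>lborel)"
    by (intro nn_integral_cong) (auto simp: indicator_def eq)
  finally show ?thesis
    unfolding TS by (simp add: emeasure_chart_volume[OF c B(1,2)] emeasure_chart_volume[OF d B(1,3)])
qed

definition is_volume :: "'a measure \<Rightarrow> bool" where
  "is_volume M \<longleftrightarrow> sets M = sets borel \<and>
     (\<forall>c\<in>\<A>. \<forall>B\<in>sets borel. B \<subseteq> chart_dom c \<longrightarrow> emeasure M B = emeasure (chart_volume c) B)"

lemma countable_chart_cover:
  obtains C :: "nat \<Rightarrow> ('a, 'n) chart" where "range C \<subseteq> \<A>" "(\<Union>n. chart_dom (C n)) = UNIV"
proof -
  obtain F where F: "F \<subseteq> chart_dom ` \<A>" "countable F" "\<Union>F = \<Union>(chart_dom ` \<A>)"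
    using Lindelof[of "chart_dom ` \<A>"] open_chart_dom by blast
  then obtain D where D: "countable D" "D \<subseteq> \<A>" "F = chart_dom ` D"
    by (meson countable_subset_image)
  have un: "\<Union>(chart_dom ` D) = UNIV" using F(3) D(3) chart_exists by auto
  then have "D \<noteq> {}" by auto
  then have "range (from_nat_into D) = D" using D(1) by (simp add: range_from_nat_into)
  moreover have "(\<Union>n. chart_dom (from_nat_into D n)) = \<Union>(chart_dom ` range (from_nat_into D))"
    by (simp only: image_image)
  ultimately show thesis using that[of "from_nat_into D"] D(2) un by simp
qed

text \<open>By second countability countably many charts suffice. Cutting their domains into
  disjoint Borel pieces reduces any Borel measure, by countable additivity, to its values inside
  single charts; uniqueness and existence of the volume both rest on this.\<close>

lemma chart_partition:
  obtains C :: "nat \<Rightarrow> ('a, 'n) chart" and P :: "nat \<Rightarrow> 'a set"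
  where "\<And>n. C n \<in> \<A>" "\<And>n. P n \<in> sets borel" "\<And>n. P n \<subseteq> chart_dom (C n)"
    "disjoint_family P" "(\<Union>n. P n) = UNIV"
proof -
  obtain C :: "nat \<Rightarrow> ('a, 'n) chart" where C: "range C \<subseteq> \<A>" "(\<Union>n. chart_dom (C n)) = UNIV"
    using countable_chart_cover by blast
  have o: "range (\<lambda>n. chart_dom (C n)) \<subseteq> sets borel"
    using borel_open[OF open_chart_dom[OF subsetD[OF C(1)]]] by blast
  show thesis
  proof (rule that[of C "disjointed (\<lambda>n. chart_dom (C n))"])
    show "C n \<in> \<A>" for n using C(1) by auto
    show "disjointed (\<lambda>n. chart_dom (C n)) n \<in> sets borel" for n
      using sets.range_disjointed_sets[OF o] by auto
    show "disjointed (\<lambda>n. chart_dom (C n)) n \<subseteq> chart_dom (C n)" for n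
      by (rule disjointed_subset)
    show "disjoint_family (disjointed (\<lambda>n. chart_dom (C n)))"
      by (rule disjoint_family_disjointed)
    show "(\<Union>n. disjointed (\<lambda>n. chart_dom (C n)) n) = UNIV"
      unfolding UN_disjointed_eq by (rule C(2))
  qed
qed

lemma emeasure_partition:
  assumes P: "\<And>n. P n \<in> sets borel" "disjoint_family P" "(\<Union>n. P n) = UNIV"
    and M: "sets M = sets borel" and B: "B \<in> sets borel"
  shows "emeasure M B = (\<Sum>n. emeasure M (B \<inter> P n))"
proof -
  have "(\<Sum>n. emeasure M (B \<inter> P n)) = emeasure M (\<Union>n. B \<inter> P n)"
  proof (rule suminf_emeasure)
    show "range (\<lambda>n. B \<inter> P n) \<subseteq> sets M" using P(1) B by (auto simp: M)
    show "disjoint_family (\<lambda>n. B \<inter> P n)" using P(2) by (auto simp: disjoint_family_on_def)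
  qed
  moreover have "(\<Union>n. B \<inter> P n) = B" using P(3) by blast
  ultimately show ?thesis by simp
qed

lemma is_volume_unique:
  assumes "is_volume M" "is_volume N"
  shows "M = N"
proof (rule measure_eqI)
  show "sets M = sets N" using assms by (simp add: is_volume_def)
  fix B assume "B \<in> sets M"
  then have B: "B \<in> sets borel" using assms by (simp add: is_volume_def)
  obtain C :: "nat \<Rightarrow> ('a, 'n) chart" and P where C: "\<And>n. C n \<in> \<A>" and P: "\<And>n. P n \<in> sets borel" "\<And>n. P n \<subseteq> chart_dom (C n)"
    "disjoint_family P" "(\<Union>n. P n) = UNIV" by (rule chart_partition) blast
  have "emeasure M (B \<inter> P n) = emeasure N (B \<inter> P n)" for n
  proof -
    have "B \<inter> P n \<in> sets borel" "B \<inter> P n \<subseteq> chart_dom (C n)" using B P by auto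
    then show ?thesis using assms C[of n] unfolding is_volume_def by metis
  qed
  then show "emeasure M B = emeasure N B"
    using emeasure_partition[OF P(1,3,4) _ B] assms by (simp add: is_volume_def)
qed

lemma is_volume_exists: "\<exists>M. is_volume M"
proof -
  obtain C :: "nat \<Rightarrow> ('a, 'n) chart" and P where C: "\<And>n. C n \<in> \<A>" and P: "\<And>n. P n \<in> sets borel" "\<And>n. P n \<subseteq> chart_dom (C n)"
    "disjoint_family P" "(\<Union>n. P n) = UNIV" by (rule chart_partition) blast
  \<comment> \<open>The sum over the pieces is written as an integral for counting measure, so that
    countable additivity becomes an interchange of sum and integral.\<close>
  define \<nu> where "\<nu> B = (\<integral>\<^sup>+n. emeasure (chart_volume (C n)) (B \<inter> P n) \<partial>count_space UNIV)" for B
  define M where "M = measure_of UNIV (sets borel) \<nu>"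
  have sets: "sets M = sets borel"
    unfolding M_def using sets.sigma_sets_eq[of "borel :: 'a measure"] by (simp add: sets_measure_of)
  have em: "emeasure M B = \<nu> B" if B: "B \<in> sets borel" for B
  proof (rule emeasure_measure_of[OF M_def])
    show "countably_additive (sets M) \<nu>"
    proof (rule countably_additiveI)
      fix F :: "nat \<Rightarrow> 'a set"
      assume F: "range F \<subseteq> sets M" "disjoint_family F" "(\<Union>i. F i) \<in> sets M"
      have "(\<Sum>i. \<nu> (F i)) =
          (\<integral>\<^sup>+n. (\<Sum>i. emeasure (chart_volume (C n)) (F i \<inter> P n)) \<partial>count_space UNIV)"
        unfolding \<nu>_def by (rule nn_integral_suminf[symmetric]) simp
      also have "\<dots> = \<nu> (\<Union>i. F i)"
        unfolding \<nu>_def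
      proof (rule nn_integral_cong)
        fix n
        have "(\<Sum>i. emeasure (chart_volume (C n)) (F i \<inter> P n)) =
            emeasure (chart_volume (C n)) (\<Union>i. F i \<inter> P n)"
        proof (rule suminf_emeasure)
          show "range (\<lambda>i. F i \<inter> P n) \<subseteq> sets (chart_volume (C n))" using F(1) P(1) sets by auto
          show "disjoint_family (\<lambda>i. F i \<inter> P n)" using F(2) by (auto simp: disjoint_family_on_def)
        qed
        also have "(\<Union>i. F i \<inter> P n) = (\<Union>i. F i) \<inter> P n" by blast
        finally show "(\<Sum>i. emeasure (chart_volume (C n)) (F i \<inter> P n)) =
            emeasure (chart_volume (C n)) ((\<Union>i. F i) \<inter> P n)" .
      qed
      finally show "(\<Sum>i. \<nu> (F i)) = \<nu> (\<Union>i. F i)" .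
    qed
    show "B \<in> sets M" using B sets by simp
  qed (auto simp: positive_def \<nu>_def)
  have "emeasure M B = emeasure (chart_volume c) B"
    if c: "c \<in> \<A>" and B: "B \<in> sets borel" "B \<subseteq> chart_dom c" for c B
  proof -
    \<comment> \<open>On each piece the chart \<open>C n\<close> used in the construction may be
      replaced by the given chart \<open>c\<close>.\<close>
    have "emeasure (chart_volume (C n)) (B \<inter> P n) = emeasure (chart_volume c) (B \<inter> P n)" for n
      by (rule emeasure_chart_volume_overlap[OF C c]) (use B P in auto)
    then have "emeasure M B = (\<Sum>n. emeasure (chart_volume c) (B \<inter> P n))"
      by (simp add: em[OF B(1)] \<nu>_def nn_integral_count_space_nat)
    also have "\<dots> = emeasure (chart_volume c) B"
      by (rule emeasure_partition[OF P(1,3,4) sets_chart_volume B(1), symmetric])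
    finally show ?thesis .
  qed
  then have "is_volume M" using sets by (simp add: is_volume_def)
  then show ?thesis ..
qed

abbreviation dv :: "'a measure" where "dv \<equiv> volume_measure \<A> g"

lemma is_volume_dv: "is_volume dv"
proof -
  have "is_volume M \<longleftrightarrow> sets M = sets borel \<and> (\<forall>c\<in>\<A>. \<forall>B\<in>sets borel. B \<subseteq> chart_dom c \<longrightarrow>
      emeasure M B = (\<integral>\<^sup>+x\<in>chart_map c ` B. ennreal (vol_density g c (chart_inv c x)) \<partial>lborel))" for M
    unfolding is_volume_def by (intro conj_cong refl ball_cong imp_cong) (simp add: emeasure_chart_volume)
  then have "volume_measure \<A> g = (THE M. is_volume M)"
    unfolding volume_measure_def by presburger
  moreover have "is_volume (THE M. is_volume M)"
    using is_volume_exists is_volume_unique by (metis theI')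
  ultimately show ?thesis by simp
qed

lemma sets_dv [simp, measurable_cong]: "sets dv = sets borel"
  using is_volume_dv by (simp add: is_volume_def)

lemma space_dv [simp]: "space dv = UNIV"
  using sets_eq_imp_space_eq[OF sets_dv] by simp

lemma restrict_dv:
  assumes "c \<in> \<A>"
  shows "restrict_space dv (chart_dom c) = restrict_space (chart_volume c) (chart_dom c)"
proof (rule measure_eqI)
  show s: "sets (restrict_space dv (chart_dom c)) = sets (restrict_space (chart_volume c) (chart_dom c))"
    by (rule sets_restrict_space_cong) simp
  fix B assume "B \<in> sets (restrict_space dv (chart_dom c))"
  then have B: "B \<in> sets borel" "B \<subseteq> chart_dom c"
    using open_chart_dom[OF assms] by (auto simp: sets_restrict_space_iff)
  then show "emeasure (restrict_space dv (chart_dom c)) B =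
      emeasure (restrict_space (chart_volume c) (chart_dom c)) B"
    using is_volume_dv assms open_chart_dom[OF assms]
    by (simp add: emeasure_restrict_space is_volume_def)
qed

text \<open>As \<open>f\<close> vanishes off the chart, nothing is lost by restricting
  \<open>dv\<close> to its domain, where \<open>dv\<close> is the image of weighted Lebesgue
  measure.\<close>

lemma integral_dv_chart:
  fixes f :: "'a \<Rightarrow> real"
  assumes c: "c \<in> \<A>" and f: "f \<in> borel_measurable borel" "\<And>p. p \<notin> chart_dom c \<Longrightarrow> f p = 0"
  shows "integrable dv f \<longleftrightarrow> integrable lborel
      (\<lambda>x. indicator (chart_img c) x *\<^sub>R (vol_density g c (chart_inv c x) * f (chart_inv c x)))"
    and "integral\<^sup>L dv f = integral\<^sup>L lborel
      (\<lambda>x. indicator (chart_img c) x *\<^sub>R (vol_density g c (chart_inv c x) * f (chart_inv c x)))"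
proof -
  let ?U = "chart_dom c" and ?V = "chart_img c"
  let ?R = "restrict_space lborel ?V"
  let ?w = "\<lambda>x. vol_density g c (chart_inv c x)"
  have U: "?U \<in> sets borel" and V: "?V \<in> sets borel"
    using open_chart_dom[OF c] open_chart_img[OF c] by auto
  have eq: "(\<lambda>p. indicator ?U p * f p) = f" using f(2) by (auto simp: indicator_def fun_eq_iff)
  have m: "chart_inv c \<in> measurable ?R borel" "?w \<in> borel_measurable ?R"
    using measurable_chart_inv[OF c] measurable_density[OF c]
    by (simp_all add: measurable_cong_sets[OF sets_restrict_lborel refl])
  have mf: "(\<lambda>x. f (chart_inv c x)) \<in> borel_measurable ?R"
    using measurable_compose[OF m(1) f(1)] .
  have nn: "AE x in ?R. 0 \<le> ?w x"
    by (rule AE_I2) (use vol_density_pos[OF c chart_inv_in_dom[OF c]] in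
        \<open>auto simp: space_restrict_space intro: less_imp_le\<close>)
  have "integrable dv f \<longleftrightarrow> integrable (restrict_space dv ?U) f"
    using integrable_restrict_space[of ?U dv f] U by (simp add: eq)
  also have "\<dots> \<longleftrightarrow> integrable (chart_volume c) f"
    unfolding restrict_dv[OF c] using integrable_restrict_space[of ?U "chart_volume c" f] U by (simp add: eq)
  also have "\<dots> \<longleftrightarrow> integrable (density ?R (\<lambda>x. ennreal (?w x))) (\<lambda>x. f (chart_inv c x))"
    unfolding chart_volume_def by (rule integrable_distr_eq) (use m f in simp_all)
  also have "\<dots> \<longleftrightarrow> integrable ?R (\<lambda>x. ?w x *\<^sub>R f (chart_inv c x))"
    by (rule integrable_density[OF mf m(2) nn])
  also have "\<dots> \<longleftrightarrow> integrable lborel (\<lambda>x. indicator ?V x *\<^sub>R (?w x * f (chart_inv c x)))"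
    using V by (subst integrable_restrict_space) auto
  finally show "integrable dv f \<longleftrightarrow> integrable lborel
      (\<lambda>x. indicator ?V x *\<^sub>R (?w x * f (chart_inv c x)))" .
  have "integral\<^sup>L dv f = integral\<^sup>L (restrict_space dv ?U) f"
    using integral_restrict_space[of ?U dv f] U by (simp add: eq)
  also have "\<dots> = integral\<^sup>L (chart_volume c) f"
    unfolding restrict_dv[OF c] using integral_restrict_space[of ?U "chart_volume c" f] U by (simp add: eq)
  also have "\<dots> = integral\<^sup>L (density ?R (\<lambda>x. ennreal (?w x))) (\<lambda>x. f (chart_inv c x))"
    unfolding chart_volume_def by (rule integral_distr) (use m f in simp_all)
  also have "\<dots> = integral\<^sup>L ?R (\<lambda>x. ?w x *\<^sub>R f (chart_inv c x))"
    by (rule integral_density[OF mf m(2) nn])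
  also have "\<dots> = integral\<^sup>L lborel (\<lambda>x. indicator ?V x *\<^sub>R (?w x * f (chart_inv c x)))"
    using V by (subst integral_restrict_space) auto
  finally show "integral\<^sup>L dv f = integral\<^sup>L lborel
      (\<lambda>x. indicator ?V x *\<^sub>R (?w x * f (chart_inv c x)))" .
qed

text \<open>Allows statements valid almost everywhere to be contradicted on a nonempty open set. A
  chart carries part of \<open>W\<close> to a nonempty open set, which is not negligible, and the
  density is positive there.\<close>

lemma emeasure_dv_open_pos:
  assumes "open W" "W \<noteq> {}"
  shows "emeasure dv W > 0"
proof -
  obtain p where p: "p \<in> W" using assms(2) by blast
  obtain c where c: "c \<in> \<A>" "p \<in> chart_dom c" using chart_exists by blast
  let ?B = "W \<inter> chart_dom c"
  have oB: "open ?B" using assms(1) open_chart_dom[OF c(1)] by blast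
  have o: "open (chart_map c ` ?B)" by (rule open_chart_map_image[OF c(1) oB]) simp
  have "\<not> negligible (chart_map c ` ?B)"
    by (rule open_not_negligible[OF o]) (use p c in auto)
  then have "emeasure lborel (chart_map c ` ?B) > 0"
    using o by (auto simp: negligible_iff_null_sets null_sets_completionI null_setsI zero_less_iff_neq_zero)
  moreover have "(\<lambda>x. ennreal (vol_density g c (chart_inv c x)) * indicator (chart_map c ` ?B) x)
      \<in> borel_measurable lborel"
  proof -
    have "continuous_on (chart_map c ` ?B) (\<lambda>x. vol_density g c (chart_inv c x))"
      by (rule continuous_on_subset[OF C1_on_continuous[OF C1_on_vol_density[OF c(1)]]]) auto
    with o have "(\<lambda>x. indicator (chart_map c ` ?B) x *\<^sub>R vol_density g c (chart_inv c x)) \<in> borel_measurable borel"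
      by (intro borel_measurable_continuous_on_indicator) auto
    then have "(\<lambda>x. ennreal (indicator (chart_map c ` ?B) x *\<^sub>R vol_density g c (chart_inv c x))) \<in> borel_measurable borel"
      by simp
    moreover have "ennreal (indicator (chart_map c ` ?B) x *\<^sub>R vol_density g c (chart_inv c x)) =
        ennreal (vol_density g c (chart_inv c x)) * indicator (chart_map c ` ?B) x" for x
      by (simp add: indicator_def)
    ultimately show ?thesis by simp
  qed
  moreover have nz: "ennreal (vol_density g c q) \<noteq> 0" if "q \<in> chart_dom c" for q
    using vol_density_pos[OF c(1) that] by (simp add: ennreal_eq_0_iff)
  moreover have "{x \<in> space lborel. ennreal (vol_density g c (chart_inv c x)) * indicator (chart_map c ` ?B) x \<noteq> 0} =
      chart_map c ` ?B"
    using nz by (auto simp: indicator_def chart_inv_map[OF c(1)])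
  ultimately have "(\<integral>\<^sup>+x\<in>chart_map c ` ?B. ennreal (vol_density g c (chart_inv c x)) \<partial>lborel) \<noteq> 0"
    by (subst nn_integral_0_iff) auto
  then have "emeasure dv ?B > 0"
    using is_volume_dv c(1) oB by (simp add: is_volume_def emeasure_chart_volume zero_less_iff_neq_zero)
  also have "emeasure dv ?B \<le> emeasure dv W" using assms(1) by (intro emeasure_mono) auto
  finally show ?thesis .
qed

section \<open>Functions of class C1 on the manifold\<close>

definition C1_mfd :: "('a \<Rightarrow> real) \<Rightarrow> bool" where
  "C1_mfd u \<longleftrightarrow> (\<forall>c\<in>\<A>. C1_on (chart_img c) (\<lambda>x. u (chart_inv c x)))"

text \<open>The differential as a covector, before the index is raised; it transforms by the
  transposed Jacobian.\<close>

definition dcoord :: "('a, 'n) chart \<Rightarrow> ('a \<Rightarrow> real) \<Rightarrow> 'a \<Rightarrow> real^'n" where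
  "dcoord c u p = grad (\<lambda>x. u (chart_inv c x)) (chart_map c p)"

text \<open>This is \<open>g(\<nabla>u, \<nabla>v)\<close>, written as the pairing of
  \<open>du\<close> with \<nabla>v, the form in which the product rule for a divergence produces
  it.\<close>

definition inner_grad :: "('a \<Rightarrow> real) \<Rightarrow> ('a \<Rightarrow> real) \<Rightarrow> 'a \<Rightarrow> real" where
  "inner_grad u v p = (let c = chart_at \<A> p in dcoord c u p \<bullet> gradient g v c p)"

lemma gradient_dcoord: "gradient g u c p = matrix_inv (g c p) *v dcoord c u p"
  by (simp add: gradient_def dcoord_def grad_def o_def)

lemma C1_mfdD: "C1_mfd u \<Longrightarrow> c \<in> \<A> \<Longrightarrow> C1_on (chart_img c) (\<lambda>x. u (chart_inv c x))"
  by (simp add: C1_mfd_def)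

lemma continuous_on_chartwise:
  fixes F :: "'a \<Rightarrow> 'b::topological_space"
  assumes "\<And>c. c \<in> \<A> \<Longrightarrow> continuous_on (chart_dom c) F"
  shows "continuous_on UNIV F"
proof (rule continuous_at_imp_continuous_on, rule ballI)
  fix p
  obtain c where "c \<in> \<A>" "p \<in> chart_dom c" using chart_exists by blast
  then show "isCont F p"
    using assms open_chart_dom continuous_on_eq_continuous_at by blast
qed

lemma continuous_on_chart_pullback:
  assumes c: "c \<in> \<A>" and F: "continuous_on (chart_img c) F"
  shows "continuous_on (chart_dom c) (\<lambda>p. F (chart_map c p))"
  by (rule continuous_on_compose2[OF F continuous_on_chart_map[OF c]]) simp

lemma C1_mfd_continuous:
  assumes "C1_mfd u"
  shows "continuous_on UNIV u"
proof (rule continuous_on_chartwise)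
  fix c assume c: "c \<in> \<A>"
  have "continuous_on (chart_dom c) (\<lambda>p. u (chart_inv c (chart_map c p)))"
    by (rule continuous_on_chart_pullback[OF c C1_on_continuous[OF C1_mfdD[OF assms c]]])
  then show "continuous_on (chart_dom c) u"
    by (rule continuous_on_cong[THEN iffD1, rotated 2]) (simp_all add: chart_inv_map[OF c])
qed

lemma continuous_on_dcoord:
  "C1_mfd u \<Longrightarrow> c \<in> \<A> \<Longrightarrow> continuous_on (chart_dom c) (dcoord c u)"
  unfolding dcoord_def
  by (rule continuous_on_chart_pullback[OF _ C1_on_continuous_grad[OF C1_mfdD]])

lemma dcoord_transform:
  assumes u: "C1_mfd u" and c: "c \<in> \<A>" and d: "d \<in> \<A>" and p: "p \<in> chart_dom c" "p \<in> chart_dom d"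
  shows "dcoord c u p = transpose (jac (transition c d) (chart_map c p)) *v dcoord d u p"
proof -
  let ?S = "chart_map c ` (chart_dom c \<inter> chart_dom d)" and ?T = "transition c d"
  have o: "open ?S"
    by (rule open_chart_map_image[OF c open_Int[OF open_chart_dom[OF c] open_chart_dom[OF d]]]) blast
  have sub: "?T ` ?S \<subseteq> chart_img d" using transition_chart_map[OF c, of _ d] by auto
  have x: "chart_map c p \<in> ?S" using p by blast
  have eq: "u (chart_inv d (?T y)) = u (chart_inv c y)" if "y \<in> ?S" for y
    using that by (auto simp: transition_chart_map[OF c] chart_inv_map[OF c] chart_inv_map[OF d])
  note comp = C1_on_compose[OF C1_on_transition[OF c d] C1_mfdD[OF u d] sub]
  have "dcoord c u p = grad (\<lambda>x. u (chart_inv d (?T x))) (chart_map c p)"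
    unfolding dcoord_def by (rule grad_cong[OF comp(1) o x eq])
  also have "\<dots> = transpose (jac ?T (chart_map c p)) *v grad (\<lambda>x. u (chart_inv d x)) (?T (chart_map c p))"
    by (rule comp(2)[OF x])
  finally show ?thesis using p by (simp add: dcoord_def transition_chart_map[OF c])
qed

lemma inner_grad_chart:
  assumes "C1_mfd u" "C1_mfd v" and c: "c \<in> \<A>" "p \<in> chart_dom c"
  shows "inner_grad u v p = dcoord c u p \<bullet> gradient g v c p"
proof -
  let ?d = "chart_at \<A> p"
  have d: "?d \<in> \<A>" "p \<in> chart_dom ?d" by (rule chart_at)+
  show ?thesis
    unfolding inner_grad_def Let_def gradient_dcoord
      dcoord_transform[OF assms(1) d(1) c(1) d(2) c(2)] dcoord_transform[OF assms(2) d(1) c(1) d(2) c(2)]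
    by (rule congruent_form_inverse[OF metric_invertible[OF d] metric_invertible[OF c]
          metric_transform[OF d(1) c(1) d(2) c(2)]])
qed

lemma norm_sq_gradient: "norm_sq \<A> g (gradient g u) p = inner_grad u u p"
  unfolding norm_sq_def inner_grad_def Let_def
  by (subst (2) gradient_dcoord)
    (simp add: matrix_inv_mult_cancel(1)[OF metric_invertible[OF chart_at]] inner_commute)

lemma inner_grad_self_nonneg: "0 \<le> inner_grad u u p"
proof -
  let ?c = "chart_at \<A> p"
  have "0 \<le> v \<bullet> (g ?c p *v v)" for v
    using metric_pos_def[OF chart_at, of v p] by (cases "v = 0") (auto intro: less_imp_le)
  then show ?thesis by (simp add: norm_sq_gradient[symmetric] norm_sq_def Let_def)
qed

text \<open>Manifold counterpart of \<open>C1_on_extend_zero\<close>: in each chart the images of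
  \<open>W\<close> and of the complement of \<open>K\<close> are open and cover.\<close>

lemma C1_mfd_glue:
  assumes W: "open W" and K: "compact K" "K \<subseteq> W"
    and u: "\<And>c. c \<in> \<A> \<Longrightarrow> C1_on (chart_map c ` (chart_dom c \<inter> W)) (\<lambda>x. u (chart_inv c x))"
    and u0: "\<And>p. p \<notin> K \<Longrightarrow> u p = 0"
  shows "C1_mfd u"
  unfolding C1_mfd_def
proof
  fix c assume c: "c \<in> \<A>"
  let ?S = "chart_map c ` (chart_dom c \<inter> W)" and ?T = "chart_map c ` (chart_dom c - K)"
  have o: "open ?S" "open ?T"
    by (rule open_chart_map_image[OF c];
      use W K(1) open_chart_dom[OF c] compact_imp_closed in \<open>auto intro!: open_Int open_Diff\<close>)+
  have "C1_on ?T (\<lambda>x. u (chart_inv c x)) \<longleftrightarrow> C1_on ?T (\<lambda>x. 0)"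
    by (rule C1_on_cong[OF o(2)]) (auto simp: chart_inv_map[OF c] u0)
  then have "C1_on (?S \<union> ?T) (\<lambda>x. u (chart_inv c x))"
    by (intro C1_on_open_Un[OF o u[OF c]]) simp
  moreover have "?S \<union> ?T = chart_img c" using K(2) by blast
  ultimately show "C1_on (chart_img c) (\<lambda>x. u (chart_inv c x))" by simp
qed

lemma C1_mfd_sum: "(\<And>i. i \<in> I \<Longrightarrow> C1_mfd (u i)) \<Longrightarrow> C1_mfd (\<lambda>p. \<Sum>i\<in>I. u i p)"
  by (simp add: C1_mfd_def C1_on_sum)

lemma inner_grad_sum:
  assumes "\<And>i. i \<in> I \<Longrightarrow> C1_mfd (u i)"
  shows "inner_grad (\<lambda>p. \<Sum>i\<in>I. u i p) v p = (\<Sum>i\<in>I. inner_grad (u i) v p)"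
proof -
  let ?c = "chart_at \<A> p"
  have "dcoord ?c (\<lambda>p. \<Sum>i\<in>I. u i p) p = (\<Sum>i\<in>I. dcoord ?c (u i) p)"
    unfolding dcoord_def by (rule grad_sum[OF C1_mfdD[OF assms chart_at(1)]]) (use chart_at in auto)
  then show ?thesis by (simp add: inner_grad_def Let_def inner_sum_left)
qed

lemma
  assumes u: "C1_mfd u" and \<phi>: "\<And>y. DERIV \<phi> y :> \<phi>' y" "continuous_on UNIV \<phi>'"
  shows C1_mfd_compose: "C1_mfd (\<lambda>p. \<phi> (u p))"
    and inner_grad_compose: "inner_grad (\<lambda>p. \<phi> (u p)) v p = \<phi>' (u p) * inner_grad u v p"
proof -
  have *: "C1_on (chart_img c) (\<lambda>x. \<phi> (u (chart_inv c x)))"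
    "x \<in> chart_img c \<Longrightarrow> grad (\<lambda>x. \<phi> (u (chart_inv c x))) x =
       \<phi>' (u (chart_inv c x)) *\<^sub>R grad (\<lambda>x. u (chart_inv c x)) x" if "c \<in> \<A>" for c x
    using C1_on_compose_DERIV[OF C1_mfdD[OF u that] \<phi>(1) continuous_on_subset[OF \<phi>(2)]] by auto
  then show "C1_mfd (\<lambda>p. \<phi> (u p))" by (simp add: C1_mfd_def)
  have "dcoord (chart_at \<A> p) (\<lambda>p. \<phi> (u p)) p = \<phi>' (u p) *\<^sub>R dcoord (chart_at \<A> p) u p"
    unfolding dcoord_def using *(2)[OF chart_at(1), of "chart_map (chart_at \<A> p) p" p] chart_at[of p]
    by (simp add: chart_inv_map)
  then show "inner_grad (\<lambda>p. \<phi> (u p)) v p = \<phi>' (u p) * inner_grad u v p"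
    by (simp add: inner_grad_def Let_def)
qed

lemma inner_grad_eq_0:
  assumes "open W" "p \<in> W" "\<And>q. q \<in> W \<Longrightarrow> u q = 0"
  shows "inner_grad u v p = 0"
proof -
  let ?c = "chart_at \<A> p"
  have c: "?c \<in> \<A>" "p \<in> chart_dom ?c" by (rule chart_at)+
  let ?S = "chart_map ?c ` (W \<inter> chart_dom ?c)"
  have "open ?S"
    by (rule open_chart_map_image[OF c(1) open_Int[OF assms(1) open_chart_dom[OF c(1)]]]) simp
  moreover have "chart_map ?c p \<in> ?S" using c assms by blast
  moreover have "0 = u (chart_inv ?c y)" if "y \<in> ?S" for y
    using that assms(3) by (auto simp: chart_inv_map[OF c(1)])
  ultimately have "grad (\<lambda>x. u (chart_inv ?c x)) (chart_map ?c p) = grad (\<lambda>x. 0) (chart_map ?c p)"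
    by (intro grad_cong[OF C1_on_const])
  then show ?thesis by (simp add: inner_grad_def dcoord_def Let_def)
qed

section \<open>Bump functions\<close>

lemma bump_exists:
  assumes "open W" "p \<in> W"
  obtains b K where "C1_mfd b" "compact K" "K \<subseteq> W" "\<And>q. q \<notin> K \<Longrightarrow> b q = 0" "\<And>q. 0 \<le> b q" "0 < b p"
proof -
  obtain c where c: "c \<in> \<A>" "p \<in> chart_dom c" using chart_exists by blast
  let ?a = "chart_map c p"
  have "open (chart_map c ` (W \<inter> chart_dom c))"
    by (rule open_chart_map_image[OF c(1) open_Int[OF assms(1) open_chart_dom[OF c(1)]]]) simp
  moreover have "?a \<in> chart_map c ` (W \<inter> chart_dom c)" using c assms by blast
  ultimately obtain \<rho> where \<rho>: "\<rho> > 0" "cball ?a \<rho> \<subseteq> chart_map c ` (W \<inter> chart_dom c)"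
    using open_contains_cball by blast
  \<comment> \<open>The squared norm keeps the argument differentiable at the centre, and
    \<open>pos_sq\<close> makes the function C1 across the sphere of radius \<rho>.\<close>
  define b where "b q = (if q \<in> chart_dom c then pos_sq (\<rho>\<^sup>2 - (norm (chart_map c q - ?a))\<^sup>2) else 0)" for q
  define K where "K = chart_inv c ` cball ?a \<rho>"
  have sub: "cball ?a \<rho> \<subseteq> chart_img c" using \<rho>(2) by blast
  have K: "compact K" unfolding K_def
    by (rule compact_continuous_image[OF continuous_on_subset[OF continuous_on_chart_inv[OF c(1)] sub]]) simp
  have KW: "K \<subseteq> W \<inter> chart_dom c"
  proof
    fix q assume "q \<in> K"
    then obtain x where "x \<in> cball ?a \<rho>" "q = chart_inv c x" by (auto simp: K_def)
    then obtain r where "r \<in> W \<inter> chart_dom c" "x = chart_map c r" using \<rho>(2) by blast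
    then show "q \<in> W \<inter> chart_dom c" using \<open>q = _\<close> by (simp add: chart_inv_map[OF c(1)])
  qed
  have b0: "b q = 0" if "q \<notin> K" for q
  proof (cases "q \<in> chart_dom c")
    case True
    then have "chart_map c q \<notin> cball ?a \<rho>"
      using that chart_inv_map[OF c(1) True] by (metis K_def imageI)
    then have "\<rho> < norm (chart_map c q - ?a)" by (simp add: dist_norm norm_minus_commute)
    then have "\<rho>\<^sup>2 < (norm (chart_map c q - ?a))\<^sup>2" using \<rho>(1) by (intro power_strict_mono) auto
    then show ?thesis by (simp add: b_def pos_sq_def)
  qed (simp add: b_def)
  have "C1_mfd b"
  proof (rule C1_mfd_glue[OF open_chart_dom[OF c(1)] K _ _ b0])
    show "K \<subseteq> chart_dom c" using KW by blast
    fix d assume d: "d \<in> \<A>"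
    let ?S = "chart_map d ` (chart_dom d \<inter> chart_dom c)"
    have o: "open ?S"
      by (rule open_chart_map_image[OF d open_Int[OF open_chart_dom[OF d] open_chart_dom[OF c(1)]]]) simp
    have 1: "C1_on ?S (\<lambda>x. (norm (transition d c x - ?a))\<^sup>2)"
      by (rule C1_on_compose(1)[OF C1_on_transition[OF d c(1)] C1_on_sqdist subset_UNIV])
    have "DERIV (\<lambda>y. pos_sq (\<rho>\<^sup>2 - y)) y :> - 2 * max 0 (\<rho>\<^sup>2 - y)" for y
    proof -
      have "DERIV (\<lambda>y. \<rho>\<^sup>2 - y) y :> - 1" by (auto intro!: derivative_eq_intros)
      from DERIV_chain2[OF DERIV_pos_sq this] show ?thesis by simp
    qed
    then have "C1_on ?S (\<lambda>x. pos_sq (\<rho>\<^sup>2 - (norm (transition d c x - ?a))\<^sup>2))"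
      by (intro C1_on_compose_DERIV(1)[OF 1, where \<phi>' = "\<lambda>y. - 2 * max 0 (\<rho>\<^sup>2 - y)"])
        (auto intro!: continuous_intros)
    then show "C1_on ?S (\<lambda>x. b (chart_inv d x))"
      by (rule C1_on_cong[OF o, THEN iffD1, rotated])
        (auto simp: b_def chart_inv_map[OF d] transition_chart_map[OF d])
  qed
  moreover have "0 < b p" using c \<rho>(1) by (simp add: b_def pos_sq_def)
  moreover have "0 \<le> b q" for q by (simp add: b_def pos_sq_def)
  moreover have "K \<subseteq> W" using KW by blast
  ultimately show thesis using that K b0 by blast
qed

section \<open>Integration over compact sets\<close>

lemma emeasure_dv_compact_chart:
  assumes c: "c \<in> \<A>" and K: "compact K" "K \<subseteq> chart_dom c"
  shows "emeasure dv K < \<infinity>"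
proof -
  let ?w = "\<lambda>x. vol_density g c (chart_inv c x)" and ?K = "chart_map c ` K"
  have K': "compact ?K" "?K \<subseteq> chart_img c"
    using K compact_continuous_image[OF continuous_on_subset[OF continuous_on_chart_map[OF c] K(2)]] by auto
  have KB: "K \<in> sets borel" using compact_imp_closed[OF K(1)] by auto
  have "integrable lborel (\<lambda>x. indicator ?K x *\<^sub>R ?w x)"
    by (rule borel_integrable_compact[OF K'(1) continuous_on_subset[OF C1_on_continuous[OF C1_on_vol_density[OF c]] K'(2)]])
  moreover have "indicator ?K x *\<^sub>R ?w x =
      indicator (chart_img c) x *\<^sub>R (?w x * indicator K (chart_inv c x))" for x
    using K(2) chart_map_image[OF c K(2)] by (auto simp: indicator_def)
  ultimately have "integrable lborel (\<lambda>x. indicator (chart_img c) x *\<^sub>R (?w x * indicator K (chart_inv c x)))"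
    by (simp only:)
  then have "integrable dv (indicator K :: 'a \<Rightarrow> real)"
    by (subst integral_dv_chart(1)[OF c]) (use K(2) KB in \<open>auto simp: indicator_def\<close>)
  then show ?thesis using KB by (simp add: integrable_indicator_iff)
qed

text \<open>The sets where bump functions are positive serve as open neighbourhoods lying in compact
  subsets of single chart domains; finitely many of them cover \<open>K\<close>.\<close>

lemma emeasure_dv_compact:
  assumes K: "compact K"
  shows "emeasure dv K < \<infinity>"
proof -
  have "\<exists>W L. open W \<and> p \<in> W \<and> W \<subseteq> L \<and> L \<in> sets dv \<and> emeasure dv L < \<infinity>" for p
  proof -
    obtain c where c: "c \<in> \<A>" "p \<in> chart_dom c" using chart_exists by blast
    obtain b L where b: "C1_mfd b" "compact L" "L \<subseteq> chart_dom c" "\<And>q. q \<notin> L \<Longrightarrow> b q = 0"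
      "\<And>q. 0 \<le> b q" "0 < b p" by (rule bump_exists[OF open_chart_dom[OF c(1)] c(2)]) blast
    have "open {q. 0 < b q}" using C1_mfd_continuous[OF b(1)] by (intro open_Collect_less) auto
    moreover have "{q. 0 < b q} \<subseteq> L" using b(4) by force
    moreover have "L \<in> sets dv" using compact_imp_closed[OF b(2)] by auto
    ultimately show ?thesis using b(6) emeasure_dv_compact_chart[OF c(1) b(2,3)] by blast
  qed
  then obtain W L where W: "\<And>p. open (W p)" "\<And>p. p \<in> W p" "\<And>p. W p \<subseteq> L p"
    and L: "\<And>p. L p \<in> sets dv" "\<And>p. emeasure dv (L p) < \<infinity>" by metis
  obtain I where I: "I \<subseteq> K" "finite I" "K \<subseteq> (\<Union>p\<in>I. W p)"
    by (rule compactE_image[OF K, of K W]) (use W in auto)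
  have "emeasure dv K \<le> emeasure dv (\<Union>p\<in>I. L p)"
    using I(2,3) W(3) L(1) by (intro emeasure_mono sets.finite_UN) blast+
  also have "\<dots> \<le> (\<Sum>p\<in>I. emeasure dv (L p))"
    by (rule emeasure_subadditive_finite[OF I(2)]) (use L(1) in auto)
  also have "\<dots> < \<infinity>" using I(2) L(2) by (simp add: less_top[symmetric])
  finally show ?thesis .
qed

lemma integrable_dv_compact:
  fixes F :: "'a \<Rightarrow> real"
  assumes F: "continuous_on UNIV F" and K: "compact K"
  shows "integrable dv (\<lambda>p. indicator K p * F p)"
proof -
  have "bounded (F ` K)"
    by (intro compact_imp_bounded compact_continuous_image continuous_on_subset[OF F] K) simp
  then obtain B where B: "\<And>p. p \<in> K \<Longrightarrow> norm (F p) \<le> B" by (auto simp: bounded_iff)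
  have "integrable dv (\<lambda>p. indicator K p *\<^sub>R F p)"
  proof (rule integrableI_bounded_set_indicator)
    show "K \<in> sets dv" using compact_imp_closed[OF K] by auto
    show "F \<in> borel_measurable dv"
      using borel_measurable_continuous_onI[OF F] by (simp add: measurable_cong_sets[OF sets_dv refl])
    show "emeasure dv K < \<infinity>" by (rule emeasure_dv_compact[OF K])
    show "AE p in dv. p \<in> K \<longrightarrow> norm (F p) \<le> B" using B by simp
  qed
  then show ?thesis by simp
qed

end

section \<open>Green's formula\<close>

locale riemannian_C2 = riemannian \<A> g
  for \<A> :: "('a::{t2_space, second_countable_topology}, 'n::finite) chart set"
    and g :: "('a, 'n) metric" +
  fixes h :: "'a \<Rightarrow> real"
  assumes h_C2: "Ck_manifold 2 \<A> h"
begin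

lemma h_C1: "C1_mfd h"
  unfolding C1_mfd_def
proof
  fix c assume c: "c \<in> \<A>"
  then have "Ck_on (Suc 1) (h \<circ> chart_inv c) (chart_img c)"
    using h_C2 by (simp add: Ck_manifold_def numeral_2_eq_2 del: Ck_on.simps)
  then show "C1_on (chart_img c) (\<lambda>x. h (chart_inv c x))"
    using Ck_on_Suc_C1_on[OF open_chart_img[OF c]] by (simp add: o_def del: Ck_on.simps)
qed

text \<open>Cramer's rule exhibits the components as quotients of determinants, which makes their C1
  regularity visible without studying \<open>matrix_inv\<close>.\<close>

lemma gradient_component:
  assumes "c \<in> \<A>" "p \<in> chart_dom c"
  shows "gradient g h c p $ k =
    det (\<chi> i j. if j = k then dcoord c h p $ i else g c p $ i $ j) / det (g c p)"
proof -
  have "g c p *v gradient g h c p = dcoord c h p"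
    unfolding gradient_dcoord by (rule matrix_inv_mult_cancel(1)[OF metric_invertible[OF assms]])
  then show ?thesis
    using cramer[of "g c p" "gradient g h c p" "dcoord c h p"] metric_det_pos[OF assms] by simp
qed

lemma C1_on_gradient:
  assumes c: "c \<in> \<A>"
  shows "C1_on (chart_img c) (\<lambda>x. gradient g h c (chart_inv c x) $ k)"
proof -
  let ?G = "grad (\<lambda>x. h (chart_inv c x))"
  have G: "C1_on (chart_img c) (\<lambda>x. ?G x $ i)" for i
    using Ck_on_2_C1_on_partial[OF open_chart_img[OF c], of "h \<circ> chart_inv c" i] h_C2 c
    by (simp add: Ck_manifold_def o_def del: Ck_on.simps)
  have "C1_on (chart_img c) (\<lambda>x. det (\<chi> i j. if j = k then ?G x $ i else g c (chart_inv c x) $ i $ j)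
      / det (g c (chart_inv c x)))"
  proof (rule C1_on_divide[OF C1_on_det C1_on_det_metric[OF c]])
    show "C1_on (chart_img c) (\<lambda>x. (\<chi> i j. if j = k then ?G x $ i else g c (chart_inv c x) $ i $ j) $ i $ j)" for i j
      by (cases "j = k") (simp_all add: G C1_on_metric[OF c])
    show "det (g c (chart_inv c x)) \<noteq> 0" if "x \<in> chart_img c" for x
      using metric_det_pos[OF c chart_inv_in_dom[OF c that]] by simp
  qed
  then show ?thesis
    by (rule C1_on_cong[OF open_chart_img[OF c], THEN iffD1, rotated])
      (simp add: gradient_component[OF c chart_inv_in_dom[OF c]] dcoord_def chart_map_inv[OF c] cong: if_cong)
qed

text \<open>The component of \<nabla>h as a vector density, whose Euclidean divergence is the
  Riemannian one times the density.\<close>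

definition flux :: "('a, 'n) chart \<Rightarrow> 'n \<Rightarrow> real^'n \<Rightarrow> real" where
  "flux c i x = vol_density g c (chart_inv c x) * gradient g h c (chart_inv c x) $ i"

text \<open>The Laplacian of \<open>h\<close> computed in a fixed chart, where it is continuous.
  \<open>laplacian\<close> uses \<open>chart_at\<close>, which may jump from point to point, so the
  two can be identified only after chart independence is known.\<close>

definition lap :: "('a, 'n) chart \<Rightarrow> 'a \<Rightarrow> real" where
  "lap c p = (\<Sum>i\<in>UNIV. grad (flux c i) (chart_map c p) $ i) / vol_density g c p"

lemma laplacian_lap: "laplacian \<A> g h p = lap (chart_at \<A> p) p"
  by (simp add: laplacian_def divergence_def Let_def lap_def grad_def flux_def[abs_def])

lemma C1_on_flux: "c \<in> \<A> \<Longrightarrow> C1_on (chart_img c) (flux c i)"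
  unfolding flux_def by (intro C1_on_mult C1_on_vol_density C1_on_gradient)

lemma continuous_on_vol_density: "c \<in> \<A> \<Longrightarrow> continuous_on (chart_dom c) (vol_density g c)"
  using continuous_on_chart_pullback[OF _ C1_on_continuous[OF C1_on_vol_density]]
  by (rule continuous_on_cong[THEN iffD1, rotated 2]) (auto simp: chart_inv_map)

lemma continuous_on_lap:
  assumes c: "c \<in> \<A>"
  shows "continuous_on (chart_dom c) (lap c)"
  unfolding lap_def
  using continuous_on_chart_pullback[OF c C1_on_continuous_grad[OF C1_on_flux[OF c]]]
    continuous_on_vol_density[OF c] less_imp_neq[OF vol_density_pos[OF c]]
  by (intro continuous_on_divide continuous_on_sum continuous_on_component) fastforce+

lemma continuous_on_inner_grad:
  assumes u: "C1_mfd u"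
  shows "continuous_on UNIV (inner_grad u h)"
proof (rule continuous_on_chartwise)
  fix c assume c: "c \<in> \<A>"
  have "continuous_on (chart_dom c) (\<lambda>p. gradient g h c (chart_inv c (chart_map c p)) $ i)" for i
    by (rule continuous_on_chart_pullback[OF c C1_on_continuous[OF C1_on_gradient[OF c]]])
  then have "continuous_on (chart_dom c) (\<lambda>p. \<chi> i. gradient g h c (chart_inv c (chart_map c p)) $ i)"
    by (rule continuous_on_vec_lambda)
  then have "continuous_on (chart_dom c) (\<lambda>p. dcoord c u p \<bullet> (\<chi> i. gradient g h c (chart_inv c (chart_map c p)) $ i))"
    by (intro continuous_on_inner continuous_on_dcoord[OF u c])
  then show "continuous_on (chart_dom c) (inner_grad u h)"
    by (rule continuous_on_cong[THEN iffD1, rotated 2])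
      (simp_all add: inner_grad_chart[OF u h_C1 c] chart_inv_map[OF c])
qed

text \<open>In coordinates the integrand times the density is the Euclidean divergence of
  \<open>u\<close> times the flux. Extended by zero this is a compactly supported C1 field, so each
  partial derivative integrates to zero.\<close>

lemma green_chart:
  assumes c: "c \<in> \<A>" and u: "C1_mfd u" and K: "compact K" "K \<subseteq> chart_dom c" and u0: "\<And>p. p \<notin> K \<Longrightarrow> u p = 0"
  shows "integrable dv (\<lambda>p. u p * lap c p + inner_grad u h p)"
    and "(\<integral>p. u p * lap c p + inner_grad u h p \<partial>dv) = 0"
proof -
  let ?U = "chart_dom c" and ?V = "chart_img c"
  let ?k = "\<lambda>p. u p * lap c p + inner_grad u h p"
  let ?u = "\<lambda>x. u (chart_inv c x)"
  let ?K = "chart_map c ` K"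
  define f where "f i x = (if x \<in> ?V then ?u x * flux c i x else 0)" for i x
  have k0: "?k p = 0" if "p \<notin> K" for p
    using inner_grad_eq_0[of "- K" p u h] u0 that compact_imp_closed[OF K(1)] by auto
  \<comment> \<open>\<open>lap c\<close> is meaningful only on the chart domain; outside it the
    integrand is 0 because \<open>u\<close> vanishes near every such point.\<close>
  have km: "?k \<in> borel_measurable borel"
  proof -
    have "continuous_on ?U ?k"
      by (intro continuous_intros continuous_on_lap[OF c] continuous_on_subset[OF C1_mfd_continuous[OF u]]
          continuous_on_subset[OF continuous_on_inner_grad[OF u]]) auto
    then have "(\<lambda>p. indicator ?U p *\<^sub>R ?k p) \<in> borel_measurable borel"
      using open_chart_dom[OF c] by (intro borel_measurable_continuous_on_indicator) auto
    moreover have "(\<lambda>p. indicator ?U p *\<^sub>R ?k p) = ?k"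
      using k0 K(2) by (auto simp: indicator_def fun_eq_iff)
    ultimately show ?thesis by simp
  qed
  have K': "compact ?K" "?K \<subseteq> ?V"
    using K compact_continuous_image[OF continuous_on_subset[OF continuous_on_chart_map[OF c] K(2)]] by auto
  have C1: "C1_on ?V (\<lambda>x. ?u x * flux c i x)" for i
    by (intro C1_on_mult C1_mfdD[OF u c] C1_on_flux[OF c])
  have z: "?u x * flux c i x = 0" if "x \<in> ?V - ?K" for x i
  proof -
    have "chart_inv c x \<notin> K" using that chart_map_inv[OF c] by (metis DiffE imageI)
    then show ?thesis using u0 by simp
  qed
  note ext = C1_on_extend_zero[OF open_chart_img[OF c] C1 K' z]
  have f: "C1_on UNIV (f i)" for i unfolding f_def by (rule ext(1))
  have f0: "f i x = 0" if "x \<notin> ?K" for i x using z[of x] that by (auto simp: f_def)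
  have gf: "grad (f i) x = (if x \<in> ?V then grad (\<lambda>x. ?u x * flux c i x) x else 0)" for i x
    unfolding f_def by (rule ext(2))
  have sum: "indicator ?V x *\<^sub>R (vol_density g c (chart_inv c x) * ?k (chart_inv c x)) =
      (\<Sum>i\<in>UNIV. grad (f i) x $ i)" for x
  proof (cases "x \<in> ?V")
    case True
    let ?p = "chart_inv c x"
    have p: "?p \<in> ?U" "chart_map c ?p = x" using True chart_inv_in_dom[OF c] chart_map_inv[OF c] by auto
    have w: "vol_density g c ?p > 0" by (rule vol_density_pos[OF c p(1)])
    have "(\<Sum>i\<in>UNIV. grad (f i) x $ i) =
        (\<Sum>i\<in>UNIV. ?u x * grad (flux c i) x $ i + flux c i x * grad ?u x $ i)"
      using True by (simp add: gf grad_mult[OF C1_mfdD[OF u c] C1_on_flux[OF c]])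
    also have "\<dots> = ?u x * (\<Sum>i\<in>UNIV. grad (flux c i) x $ i) +
        vol_density g c ?p * (grad ?u x \<bullet> gradient g h c ?p)"
      by (simp add: sum.distrib sum_distrib_left flux_def inner_vec_def mult_ac)
    also have "(\<Sum>i\<in>UNIV. grad (flux c i) x $ i) = vol_density g c ?p * lap c ?p"
      using w by (simp add: lap_def p(2))
    also have "grad ?u x \<bullet> gradient g h c ?p = inner_grad u h ?p"
      by (simp add: inner_grad_chart[OF u h_C1 c p(1)] dcoord_def p(2))
    finally show ?thesis using True by (simp add: algebra_simps)
  qed (simp add: gf)
  have k0': "?k p = 0" if "p \<notin> ?U" for p using k0 that K(2) by blast
  have part: "integrable lborel (\<lambda>x. grad (f i) x $ i)" "(\<integral>x. grad (f i) x $ i \<partial>lborel) = 0" for i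
    by (rule integral_partial_eq_0[OF f K'(1)]; rule f0; assumption)+
  have "integrable dv ?k \<longleftrightarrow> integrable lborel (\<lambda>x. \<Sum>i\<in>UNIV. grad (f i) x $ i)"
    unfolding sum[symmetric] by (rule integral_dv_chart(1)[OF c km]) (rule k0')
  then show "integrable dv ?k"
    using part(1) by simp
  have "integral\<^sup>L dv ?k = (\<integral>x. (\<Sum>i\<in>UNIV. grad (f i) x $ i) \<partial>lborel)"
    unfolding sum[symmetric] by (rule integral_dv_chart(2)[OF c km]) (rule k0')
  also have "\<dots> = 0"
    using part by simp
  finally show "integral\<^sup>L dv ?k = 0" .
qed

text \<open>
  The chart independence of the Laplacian is read off its weak form: by Green's formula in either
  chart, the integral of \<open>b lap c\<close> against a bump function \<open>b\<close> is minus that of the pairing of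
  the gradients of \<open>b\<close> and \<open>h\<close>, which is chart independent by first-order calculus.
\<close>

lemma lap_le_overlap:
  assumes c: "c \<in> \<A>" "p \<in> chart_dom c" and d: "d \<in> \<A>" "p \<in> chart_dom d"
  shows "lap c p \<le> lap d p"
proof (rule ccontr)
  assume "\<not> lap c p \<le> lap d p"
  then have pos: "0 < lap c p - lap d p" by simp
  let ?W = "chart_dom c \<inter> chart_dom d" and ?\<delta> = "\<lambda>q. lap c q - lap d q"
  have oW: "open ?W" using open_chart_dom c d by blast
  have \<delta>: "continuous_on ?W ?\<delta>"
    by (intro continuous_intros continuous_on_subset[OF continuous_on_lap[OF c(1)]]
        continuous_on_subset[OF continuous_on_lap[OF d(1)]]) auto
  let ?N = "?W \<inter> ?\<delta> -` {0<..}"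
  \<comment> \<open>With the bump supported in \<open>?N\<close>, the integrand
    \<open>b q * ?\<delta> q\<close> is nonnegative everywhere and positive wherever
    \<open>b\<close> is, while Green's formula in the two charts makes its integral zero.\<close>
  have oN: "open ?N" using continuous_open_preimage[OF \<delta> oW, of "{0<..}"] by simp
  have pN: "p \<in> ?N" using c d pos by simp
  obtain b K where b: "C1_mfd b" "compact K" "K \<subseteq> ?N" "\<And>q. q \<notin> K \<Longrightarrow> b q = 0"
    "\<And>q. 0 \<le> b q" "0 < b p" by (rule bump_exists[OF oN pN]) blast
  have K: "K \<subseteq> chart_dom c" "K \<subseteq> chart_dom d" using b(3) by auto
  have gc: "integrable dv (\<lambda>q. b q * lap c q + inner_grad b h q)"
      "(\<integral>q. b q * lap c q + inner_grad b h q \<partial>dv) = 0"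
    by (rule green_chart[OF c(1) b(1,2) K(1)]; rule b(4); assumption)+
  have gd: "integrable dv (\<lambda>q. b q * lap d q + inner_grad b h q)"
      "(\<integral>q. b q * lap d q + inner_grad b h q \<partial>dv) = 0"
    by (rule green_chart[OF d(1) b(1,2) K(2)]; rule b(4); assumption)+
  let ?f = "\<lambda>q. b q * ?\<delta> q"
  have f: "?f = (\<lambda>q. (b q * lap c q + inner_grad b h q) - (b q * lap d q + inner_grad b h q))"
    by (simp add: algebra_simps)
  have nn: "0 \<le> ?f q" for q
  proof (cases "q \<in> K")
    case True
    then have "0 < ?\<delta> q" using b(3) by blast
    then show ?thesis using b(5)[of q] by simp
  qed (simp add: b(4))
  have int: "integrable dv ?f"
    unfolding f by (rule Bochner_Integration.integrable_diff[OF gc(1) gd(1)])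
  have "integral\<^sup>L dv ?f = 0"
    unfolding f Bochner_Integration.integral_diff[OF gc(1) gd(1)] gc(2) gd(2) by simp
  then have "AE q in dv. ?f q = 0"
    using integral_nonneg_eq_0_iff_AE[OF int] nn by simp
  then have "AE q in dv. q \<notin> {q. 0 < b q}"
  proof (rule AE_mp, intro AE_I2 impI)
    fix q assume "?f q = 0"
    show "q \<notin> {q. 0 < b q}"
    proof
      assume "q \<in> {q. 0 < b q}"
      then have "b q \<noteq> 0" "q \<in> K" using b(4)[of q] by auto
      then show False using \<open>?f q = 0\<close> b(3) by auto
    qed
  qed
  then have "emeasure dv {q. 0 < b q} = 0"
    using emeasure_eq_0_AE[of "\<lambda>q. 0 < b q" dv] by simp
  moreover have "open {q. 0 < b q}"
    using C1_mfd_continuous[OF b(1)] by (intro open_Collect_less) auto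
  then have "emeasure dv {q. 0 < b q} > 0"
    by (rule emeasure_dv_open_pos) (use b(6) in auto)
  ultimately show False by simp
qed

lemma laplacian_chart: "c \<in> \<A> \<Longrightarrow> p \<in> chart_dom c \<Longrightarrow> laplacian \<A> g h p = lap c p"
  unfolding laplacian_lap by (intro antisym lap_le_overlap chart_at)

lemma continuous_on_laplacian: "continuous_on UNIV (laplacian \<A> g h)"
proof (rule continuous_on_chartwise)
  fix c assume c: "c \<in> \<A>"
  show "continuous_on (chart_dom c) (laplacian \<A> g h)"
    using continuous_on_lap[OF c]
    by (rule continuous_on_cong[THEN iffD1, rotated 2]) (simp_all add: laplacian_chart[OF c])
qed

lemma green_small:
  assumes c: "c \<in> \<A>" and u: "C1_mfd u" and K: "compact K" "K \<subseteq> chart_dom c" and u0: "\<And>p. p \<notin> K \<Longrightarrow> u p = 0"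
  shows "integrable dv (\<lambda>p. u p * laplacian \<A> g h p + inner_grad u h p)"
    and "(\<integral>p. u p * laplacian \<A> g h p + inner_grad u h p \<partial>dv) = 0"
proof -
  have "u p * laplacian \<A> g h p = u p * lap c p" for p
    using u0[of p] K(2) laplacian_chart[OF c, of p] by (cases "p \<in> K") auto
  then have eq: "(\<lambda>p. u p * laplacian \<A> g h p + inner_grad u h p) = (\<lambda>p. u p * lap c p + inner_grad u h p)"
    by presburger
  show "integrable dv (\<lambda>p. u p * laplacian \<A> g h p + inner_grad u h p)"
    "(\<integral>p. u p * laplacian \<A> g h p + inner_grad u h p \<partial>dv) = 0"
    unfolding eq by (rule green_chart[OF c u K]; rule u0; assumption)+
qed

text \<open>Both sides are linear in \<open>u\<close>, so it suffices to split \<open>u\<close> into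
  finitely many C1 functions, each with compact support in a chart domain.\<close>

lemma green:
  assumes u: "C1_mfd u" and K: "compact K" and u0: "\<And>p. p \<notin> K \<Longrightarrow> u p = 0"
  shows "integrable dv (\<lambda>p. u p * laplacian \<A> g h p + inner_grad u h p)"
    and "(\<integral>p. u p * laplacian \<A> g h p + inner_grad u h p \<partial>dv) = 0"
proof -
  have "\<exists>b L c. C1_mfd b \<and> compact L \<and> c \<in> \<A> \<and> L \<subseteq> chart_dom c \<and> (\<forall>q. q \<notin> L \<longrightarrow> b q = 0) \<and>
    (\<forall>q. 0 \<le> b q) \<and> 0 < b p" for p
  proof -
    obtain c where c: "c \<in> \<A>" "p \<in> chart_dom c" using chart_exists by blast
    obtain b L where "C1_mfd b" "compact L" "L \<subseteq> chart_dom c" "\<And>q. q \<notin> L \<Longrightarrow> b q = 0"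
      "\<And>q. 0 \<le> b q" "0 < b p" by (rule bump_exists[OF open_chart_dom[OF c(1)] c(2)]) blast
    then show ?thesis using c(1) by blast
  qed
  then obtain b L C where b: "\<And>p. C1_mfd (b p)" "\<And>p q. 0 \<le> b p q" "\<And>p. 0 < b p p"
    and C: "\<And>p. C p \<in> \<A>" and L: "\<And>p. compact (L p)" "\<And>p. L p \<subseteq> chart_dom (C p)"
    and bL: "\<And>p q. q \<notin> L p \<Longrightarrow> b p q = 0" by metis
  have "open {q. 0 < b p q}" for p
    using C1_mfd_continuous[OF b(1)] by (intro open_Collect_less) auto
  then obtain I where I: "I \<subseteq> K" "finite I" "K \<subseteq> (\<Union>p\<in>I. {q. 0 < b p q})"
    using compactE_image[OF K, of K "\<lambda>p. {q. 0 < b p q}"] b(3) by (metis (mono_tags, lifting) UN_I mem_Collect_eq subsetI)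
  define B where "B q = (\<Sum>p\<in>I. b p q)" for q
  have B: "C1_mfd B" unfolding B_def by (rule C1_mfd_sum) (rule b(1))
  have BK: "K \<subseteq> {q. 0 < B q}"
  proof
    fix q assume "q \<in> K"
    then obtain p where "p \<in> I" "0 < b p q" using I(3) by auto
    then show "q \<in> {q. 0 < B q}" unfolding B_def using I(2) b(2) by (auto intro!: sum_pos2)
  qed
  have oB: "open {q. 0 < B q}"
    using C1_mfd_continuous[OF B] by (intro open_Collect_less) auto
  \<comment> \<open>The partition of unity \<open>b p / B\<close> is used only after multiplication
    by \<open>u\<close>: off \<open>K\<close>, where \<open>B\<close> may vanish, \<open>u\<close>
    and hence the quotient are 0, so no smoothing of \<open>B\<close> away from \<open>K\<close> is
    needed.\<close>
  define v where "v p q = u q * b p q / B q" for p q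
  have v: "C1_mfd (v p)" for p
  proof (rule C1_mfd_glue[OF oB K BK])
    fix c assume c: "c \<in> \<A>"
    let ?S = "chart_map c ` (chart_dom c \<inter> {q. 0 < B q})"
    have sub: "?S \<subseteq> chart_img c" by blast
    show "C1_on ?S (\<lambda>x. v p (chart_inv c x))"
      unfolding v_def
    proof (rule C1_on_divide)
      show "C1_on ?S (\<lambda>x. u (chart_inv c x) * b p (chart_inv c x))"
        by (rule C1_on_subset[OF _ sub]) (intro C1_on_mult C1_mfdD u b c)
      show "C1_on ?S (\<lambda>x. B (chart_inv c x))"
        by (rule C1_on_subset[OF C1_mfdD[OF B c] sub])
      show "B (chart_inv c x) \<noteq> 0" if "x \<in> ?S" for x
        using that by (auto simp: chart_inv_map[OF c])
    qed
  qed (simp add: v_def u0)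
  have sum: "(\<Sum>p\<in>I. v p q) = u q" for q
  proof (cases "q \<in> K")
    case True
    have "(\<Sum>p\<in>I. v p q) = u q * B q / B q"
      by (simp add: v_def B_def sum_divide_distrib sum_distrib_left)
    then show ?thesis using True BK by auto
  qed (simp add: v_def u0)
  have gv: "integrable dv (\<lambda>q. v p q * laplacian \<A> g h q + inner_grad (v p) h q)"
      "(\<integral>q. v p q * laplacian \<A> g h q + inner_grad (v p) h q \<partial>dv) = 0" for p
    by (rule green_small[OF C[of p] v[of p] L(1)[of p] L(2)[of p]]; simp add: v_def bL)+
  have "inner_grad u h q = (\<Sum>p\<in>I. inner_grad (v p) h q)" for q
    using inner_grad_sum[of I v h q, OF v] by (simp add: sum)
  then have eq: "u q * laplacian \<A> g h q + inner_grad u h q =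
      (\<Sum>p\<in>I. v p q * laplacian \<A> g h q + inner_grad (v p) h q)" for q
    by (simp add: sum.distrib sum_distrib_right[symmetric] sum)
  show "integrable dv (\<lambda>p. u p * laplacian \<A> g h p + inner_grad u h p)"
    unfolding eq using gv(1) by simp
  show "(\<integral>p. u p * laplacian \<A> g h p + inner_grad u h p \<partial>dv) = 0"
    unfolding eq using gv by simp
qed

end

section \<open>The cutoff argument\<close>

text \<open>A nonincreasing C1 step from 1 on \<open>z \<le> 0\<close> to 0 on
  \<open>z \<ge> 1\<close>; nesting two squared positive parts makes both junctions C1.\<close>

definition cutoff :: "real \<Rightarrow> real" where
  "cutoff z = pos_sq (1 - pos_sq z)"

definition cutoff_deriv :: "real \<Rightarrow> real" where
  "cutoff_deriv z = - (4 * max 0 (1 - pos_sq z) * max 0 z)"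

lemma DERIV_cutoff: "DERIV cutoff z :> cutoff_deriv z"
proof -
  have "DERIV (\<lambda>z. 1 - pos_sq z) z :> - (2 * max 0 z)"
    using DERIV_diff[OF DERIV_const DERIV_pos_sq] by simp
  from DERIV_chain2[OF DERIV_pos_sq this] show ?thesis
    by (simp add: cutoff_def[abs_def] cutoff_deriv_def mult_ac)
qed

lemma cutoff_nonpos: "z \<le> 0 \<Longrightarrow> cutoff z = 1"
  by (simp add: cutoff_def pos_sq_def max_def)

lemma cutoff_ge_1:
  assumes "1 \<le> z"
  shows "cutoff z = 0"
proof -
  have "1 \<le> pos_sq z" using assms one_le_power[of z 2] by (simp add: pos_sq_def)
  then show ?thesis by (simp add: cutoff_def pos_sq_def[of "1 - _"])
qed

lemma cutoff_bounds: "0 \<le> cutoff z" "cutoff z \<le> 1"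
proof -
  show "0 \<le> cutoff z" by (simp add: cutoff_def pos_sq_def)
  have "max 0 (1 - pos_sq z) \<le> 1" by (simp add: pos_sq_def)
  then have "(max 0 (1 - pos_sq z))\<^sup>2 \<le> 1\<^sup>2" by (intro power_mono) auto
  then show "cutoff z \<le> 1" by (simp add: cutoff_def pos_sq_def)
qed

lemma cutoff_deriv_nonpos: "cutoff_deriv z \<le> 0"
  by (simp add: cutoff_deriv_def)

section \<open>The volume estimate\<close>

text \<open>Limit of the product of \<open>n\<close> equal one-step factors, one for each step of a
  geometric grid of ratio \<open>exp (x / n)\<close>.\<close>

lemma one_minus_exp_power_tendsto:
  fixes q x :: real
  shows "(\<lambda>n. (1 - q * (exp (x / real n) - 1)) ^ n) \<longlonglongrightarrow> exp (- q * x)"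
  by real_asymp

text \<open>The bound \<open>1 / k^2\<close> is chosen because the product of the factors
  \<open>1 - 1 / k^2\<close> telescopes.\<close>

lemma eventually_gaussian_le:
  fixes \<kappa> b c :: real
  assumes "\<kappa> > 0"
  shows "\<forall>\<^sub>F k in sequentially. exp (- \<kappa> * (real k)\<^sup>2 + b * real k + c) \<le> 1 / (real k)\<^sup>2"
  using assms by real_asymp

text \<open>At \<epsilon> = 0 the left side equals \<open>\<alpha> / 4\<close>, and its derivative
  there is \<open>a2 - \<beta> / 4 < 0\<close>.\<close>

lemma exists_epsilon:
  fixes \<alpha> \<beta> a2 :: real
  assumes "\<alpha> > 0" "\<beta> > 0" "a2 < \<beta> / 4"
  shows "\<exists>\<epsilon>>0. \<epsilon> * a2 + \<alpha> / (4 * exp (\<epsilon> * (\<beta> / \<alpha>))) < \<alpha> / 4"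
proof -
  let ?\<phi> = "\<lambda>\<epsilon>. \<epsilon> * a2 + \<alpha> / 4 * exp (- (\<epsilon> * (\<beta> / \<alpha>)))"
  have "DERIV ?\<phi> 0 :> a2 - \<beta> / 4"
    using assms(1) by (auto intro!: derivative_eq_intros)
  then obtain d where d: "d > 0" "\<And>e. 0 < e \<Longrightarrow> e < d \<Longrightarrow> ?\<phi> (0 + e) < ?\<phi> 0"
    using DERIV_neg_dec_right[of ?\<phi> "a2 - \<beta> / 4" 0] assms(3) by auto
  then have "?\<phi> (d / 2) < \<alpha> / 4" using d(2)[of "d / 2"] by simp
  then show ?thesis using d(1) by (intro exI[of _ "d / 2"]) (simp add: exp_minus field_simps)
qed

locale proper_C2 = riemannian_C2 \<A> g h
  for \<A> :: "('a::{t2_space, second_countable_topology}, 'n::finite) chart set"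
    and g :: "('a, 'n) metric" and h :: "'a \<Rightarrow> real" +
  assumes h_proper: "proper_fun h" and h_nonneg: "0 \<le> h p"
begin

abbreviation "\<Delta> \<equiv> laplacian \<A> g h"
abbreviation "\<Gamma> \<equiv> inner_grad h h"
text \<open>Indexed by the bound on \<open>h\<close> itself; for \<open>r \<ge> 0\<close> the set
  \<open>D_r\<close> of the theorem is \<open>D (r^2 / 4)\<close>.\<close>

abbreviation "D R \<equiv> {p. h p \<le> R}"

lemma compact_D: "compact (D R)"
proof -
  have "D R = h -` {0..R}" using h_nonneg by auto
  then show ?thesis using h_proper by (simp add: proper_fun_def)
qed

lemma continuous_h: "continuous_on UNIV h"
  by (rule C1_mfd_continuous[OF h_C1])

lemma borel_D: "D R \<in> sets borel"
  using compact_imp_closed[OF compact_D] by auto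

lemma integrable_D:
  fixes F :: "'a \<Rightarrow> real"
  shows "continuous_on UNIV F \<Longrightarrow> integrable dv (\<lambda>p. indicator (D R) p * F p)"
  by (rule integrable_dv_compact[OF _ compact_D])

lemma continuous_weighted:
  "continuous_on UNIV (\<lambda>p. exp (- s * h p) * (\<Delta> p - s * \<Gamma> p))"
  by (intro continuous_intros continuous_on_laplacian continuous_on_inner_grad h_C1 continuous_h)

text \<open>
  By Green's formula the boundary flux of the field exp (-s h) grad h through the level set
  is replaced by the integral of the derivative of a cutoff, which has a sign; no regularity of
  the level set is required.
\<close>

lemma weighted_laplacian_cutoff_nonneg:
  assumes "n \<ge> 1"
  shows "0 \<le> (\<integral>p. cutoff (real n * (h p - R)) * (exp (- s * h p) * (\<Delta> p - s * \<Gamma> p)) \<partial>dv)"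
proof -
  let ?z = "\<lambda>y. real n * (y - R)"
  let ?\<psi> = "\<lambda>y. cutoff (?z y) * exp (- s * y)"
  let ?\<psi>' = "\<lambda>y. (real n * cutoff_deriv (?z y) - s * cutoff (?z y)) * exp (- s * y)"
  let ?E = "\<lambda>p. exp (- s * h p) * (\<Delta> p - s * \<Gamma> p)"
  have dz: "DERIV ?z y :> real n" for y by (auto intro!: derivative_eq_intros)
  have dc: "DERIV (\<lambda>y. cutoff (?z y)) y :> cutoff_deriv (?z y) * real n" for y
    by (rule DERIV_chain2[OF DERIV_cutoff dz])
  have de: "DERIV (\<lambda>y. exp (- s * y)) y :> - s * exp (- s * y)" for y
    by (auto intro!: derivative_eq_intros)
  have d\<psi>: "DERIV ?\<psi> y :> ?\<psi>' y" for y
    using DERIV_mult[OF dc de] by (rule DERIV_cong) (simp add: algebra_simps)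
  have c\<psi>: "continuous_on UNIV ?\<psi>'"
    unfolding cutoff_deriv_def cutoff_def pos_sq_def by (intro continuous_intros)
  \<comment> \<open>Since \<open>n \<ge> 1\<close>, the transition layer always lies in
    \<open>h \<le> R + 1\<close>, so one compact set serves for all \<open>n\<close>.\<close>
  have z0: "cutoff (?z (h p)) = 0" if "p \<notin> D (R + 1)" for p
  proof (rule cutoff_ge_1)
    have "1 * 1 \<le> real n * (h p - R)" using that assms by (intro mult_mono) auto
    then show "1 \<le> ?z (h p)" by simp
  qed
  have C1: "C1_mfd (\<lambda>p. ?\<psi> (h p))" by (rule C1_mfd_compose[OF h_C1 d\<psi> c\<psi>])
  have 0: "?\<psi> (h p) = 0" if "p \<notin> D (R + 1)" for p using z0[OF that] by simp
  have ig: "inner_grad (\<lambda>p. ?\<psi> (h p)) h p = ?\<psi>' (h p) * \<Gamma> p" for p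
    by (rule inner_grad_compose[OF h_C1 d\<psi> c\<psi>])
  have green: "integrable dv (\<lambda>p. ?\<psi> (h p) * \<Delta> p + ?\<psi>' (h p) * \<Gamma> p)"
    "(\<integral>p. ?\<psi> (h p) * \<Delta> p + ?\<psi>' (h p) * \<Gamma> p \<partial>dv) = 0"
    using green[OF C1 compact_D 0] unfolding ig by auto
  have "continuous_on UNIV (\<lambda>p. cutoff (?z (h p)) * ?E p)"
    unfolding cutoff_def pos_sq_def
    by (intro continuous_on_mult[OF _ continuous_weighted] continuous_intros continuous_h)
  then have "integrable dv (\<lambda>p. indicator (D (R + 1)) p * (cutoff (?z (h p)) * ?E p))"
    by (rule integrable_D)
  moreover have "indicator (D (R + 1)) p * (cutoff (?z (h p)) * ?E p) = cutoff (?z (h p)) * ?E p" for p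
    using z0[of p] by (cases "p \<in> D (R + 1)") auto
  ultimately have int: "integrable dv (\<lambda>p. cutoff (?z (h p)) * ?E p)" by (simp only:)
  have "?\<psi> (h p) * \<Delta> p + ?\<psi>' (h p) * \<Gamma> p \<le> cutoff (?z (h p)) * ?E p" for p
  proof -
    \<comment> \<open>The only term in which the derivative falls on the cutoff. Having a sign it is
      dropped, so its growth with \<open>n\<close> does no harm.\<close>
    have "real n * cutoff_deriv (?z (h p)) * exp (- s * h p) * \<Gamma> p \<le> 0"
      using cutoff_deriv_nonpos[of "?z (h p)"] inner_grad_self_nonneg[of h p]
      by (intro mult_nonpos_nonneg mult_nonneg_nonpos) auto
    then show ?thesis by (simp add: algebra_simps)
  qed
  then have "(\<integral>p. ?\<psi> (h p) * \<Delta> p + ?\<psi>' (h p) * \<Gamma> p \<partial>dv) \<le> (\<integral>p. cutoff (?z (h p)) * ?E p \<partial>dv)"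
    by (intro integral_mono green int)
  then show ?thesis unfolding green(2) .
qed

text \<open>As the transition layer shrinks, the cutoffs converge to the indicator of the closed
  sublevel set, because \<open>cutoff 0 = 1\<close>. Dominated convergence applies with the compact
  set \<open>D (R + 1)\<close>.\<close>

lemma weighted_laplacian_nonneg:
  "0 \<le> (\<integral>p. indicator (D R) p * (exp (- s * h p) * (\<Delta> p - s * \<Gamma> p)) \<partial>dv)"
proof -
  let ?E = "\<lambda>p. exp (- s * h p) * (\<Delta> p - s * \<Gamma> p)"
  let ?f = "\<lambda>n p. cutoff (real (Suc n) * (h p - R)) * ?E p"
  have mE: "?E \<in> borel_measurable dv" "h \<in> borel_measurable dv"
    using borel_measurable_continuous_onI[OF continuous_weighted] borel_measurable_continuous_onI[OF continuous_h]
    by (simp_all add: measurable_cong_sets[OF sets_dv refl])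
  have mc: "cutoff \<in> borel_measurable borel"
    using DERIV_cutoff DERIV_isCont by (intro borel_measurable_continuous_onI continuous_at_imp_continuous_on) blast
  have "(\<lambda>n. integral\<^sup>L dv (?f n)) \<longlonglongrightarrow> (\<integral>p. indicator (D R) p * ?E p \<partial>dv)"
  proof (rule integral_dominated_convergence[where w = "\<lambda>p. indicator (D (R + 1)) p * \<bar>?E p\<bar>"])
    show "integrable dv (\<lambda>p. indicator (D (R + 1)) p * \<bar>?E p\<bar>)"
      by (intro integrable_D continuous_on_rabs continuous_weighted)
    show "(\<lambda>p. indicator (D R) p * ?E p) \<in> borel_measurable dv"
      using integrable_D[OF continuous_weighted] by (rule borel_measurable_integrable)
    show "?f n \<in> borel_measurable dv" for n
      using mE measurable_compose[OF _ mc, of "\<lambda>p. real (Suc n) * (h p - R)" dv] by measurable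
    show "AE p in dv. (\<lambda>n. ?f n p) \<longlonglongrightarrow> indicator (D R) p * ?E p"
    proof (rule AE_I2)
      fix p
      have "(\<lambda>n. cutoff (real (Suc n) * (h p - R))) \<longlonglongrightarrow> indicator (D R) p"
      proof (cases "p \<in> D R")
        case True
        then have "cutoff (real (Suc n) * (h p - R)) = 1" for n
          by (intro cutoff_nonpos mult_nonneg_nonpos) auto
        then show ?thesis using True by simp
      next
        case False
        then have "0 < h p - R" by simp
        then obtain N where N: "1 < real N * (h p - R)" using reals_Archimedean3 by blast
        have "cutoff (real (Suc n) * (h p - R)) = 0" if "n \<ge> N" for n
        proof (rule cutoff_ge_1)
          have "real N * (h p - R) \<le> real (Suc n) * (h p - R)"
            using that \<open>0 < h p - R\<close> by (intro mult_right_mono) auto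
          then show "1 \<le> real (Suc n) * (h p - R)" using N by linarith
        qed
        then have "\<forall>\<^sub>F n in sequentially. cutoff (real (Suc n) * (h p - R)) = indicator (D R) p"
          using False by (auto simp: eventually_sequentially)
        then show ?thesis by (rule tendsto_eventually)
      qed
      then show "(\<lambda>n. ?f n p) \<longlonglongrightarrow> indicator (D R) p * ?E p" by (intro tendsto_intros)
    qed
    show "AE p in dv. norm (?f n p) \<le> indicator (D (R + 1)) p * \<bar>?E p\<bar>" for n
    proof (rule AE_I2)
      fix p
      show "norm (?f n p) \<le> indicator (D (R + 1)) p * \<bar>?E p\<bar>"
      proof (cases "p \<in> D (R + 1)")
        case True
        then show ?thesis
          using cutoff_bounds[of "real (Suc n) * (h p - R)"] by (simp add: abs_mult mult_left_le_one_le del: of_nat_Suc)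
      next
        case False
        have "1 * 1 \<le> real (Suc n) * (h p - R)" using False by (intro mult_mono) auto
        then have "cutoff (real (Suc n) * (h p - R)) = 0" by (intro cutoff_ge_1) simp
        then show ?thesis by (simp del: of_nat_Suc)
      qed
    qed
  qed
  then show ?thesis
    by (rule LIMSEQ_le_const) (intro exI[of _ 0] allI impI weighted_laplacian_cutoff_nonneg, simp)
qed

section \<open>The weighted volume of a sublevel set as a function of the exponent\<close>

definition weighted_volume :: "real \<Rightarrow> real \<Rightarrow> real" where
  "weighted_volume R s = (\<integral>p. indicator (D R) p * exp (- s * h p) \<partial>dv)"

lemma integrable_weight: "integrable dv (\<lambda>p. indicator (D R) p * exp (- s * h p))"
  by (intro integrable_D continuous_intros continuous_h)

lemma weighted_volume_nonneg: "0 \<le> weighted_volume R s"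
  unfolding weighted_volume_def by (intro integral_nonneg_AE AE_I2) auto

context
  fixes \<alpha> \<beta> P R :: real
  assumes \<alpha>: "\<alpha> > 0" and \<beta>: "\<beta> > 0"
    and ineq1: "\<And>p. h p \<le> R \<Longrightarrow> \<Delta> p - \<alpha> * \<Gamma> p + \<beta> * h p \<le> P"
    and ineq2: "\<And>p. h p \<le> R \<Longrightarrow> \<Delta> p \<le> P"
begin

text \<open>
  The convex combination with weights \<open>u\<close> and \<open>1 - u\<close> of the two differential
  inequalities is \<open>\<Delta> - \<alpha> u \<Gamma> + \<beta> u h \<le> P\<close>.
\<close>

lemma weighted_moment_le:
  assumes u: "0 \<le> u" "u \<le> 1"
  shows "\<beta> * u * (\<integral>p. indicator (D R) p * (h p * exp (- (\<alpha> * u) * h p)) \<partial>dv)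
    \<le> P * weighted_volume R (\<alpha> * u)"
proof -
  let ?E = "\<lambda>p. exp (- (\<alpha> * u) * h p)"
  let ?L = "\<lambda>p. indicator (D R) p * (?E p * (\<Delta> p - (\<alpha> * u) * \<Gamma> p))"
  let ?M = "\<lambda>p. indicator (D R) p * (h p * ?E p)"
  let ?W = "\<lambda>p. indicator (D R) p * ?E p"
  have int: "integrable dv ?L" "integrable dv ?M" "integrable dv ?W"
    by (intro integrable_D continuous_weighted integrable_weight continuous_intros continuous_h)+
  have "\<beta> * u * ?M p + ?L p \<le> P * ?W p" for p
  proof (cases "p \<in> D R")
    case True
    have "(1 - u) * \<Delta> p + u * (\<Delta> p - \<alpha> * \<Gamma> p + \<beta> * h p) \<le> (1 - u) * P + u * P"
      using u ineq1[of p] ineq2[of p] True by (intro add_mono mult_left_mono) auto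
    then have "\<Delta> p - \<alpha> * u * \<Gamma> p + \<beta> * u * h p \<le> P" by (simp add: algebra_simps)
    then have "?E p * (\<Delta> p - \<alpha> * u * \<Gamma> p + \<beta> * u * h p) \<le> ?E p * P" by (intro mult_left_mono) auto
    then show ?thesis using True by (simp add: algebra_simps)
  qed simp
  then have "(\<integral>p. \<beta> * u * ?M p + ?L p \<partial>dv) \<le> (\<integral>p. P * ?W p \<partial>dv)"
    using int by (intro integral_mono) auto
  moreover have "(\<integral>p. \<beta> * u * ?M p + ?L p \<partial>dv) = \<beta> * u * integral\<^sup>L dv ?M + integral\<^sup>L dv ?L"
    using int by (subst Bochner_Integration.integral_add) auto
  moreover have "(\<integral>p. P * ?W p \<partial>dv) = P * weighted_volume R (\<alpha> * u)"
    by (simp add: weighted_volume_def)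
  moreover have "0 \<le> integral\<^sup>L dv ?L" by (rule weighted_laplacian_nonneg)
  ultimately show ?thesis by linarith
qed

text \<open>A discrete form of the differential inequality: \<open>1 - t \<le> exp (- t)\<close>
  bounds the decrease of the weighted volume from \<open>u\<close> to \<open>v\<close> by the first
  moment at \<open>u\<close>, and the moment estimate applies. Only the ratio \<open>v / u\<close>
  enters, which suggests a geometric grid.\<close>

lemma weighted_volume_step:
  assumes u: "0 < u" "u \<le> v" "v \<le> 1"
  shows "weighted_volume R (\<alpha> * u) * (1 - \<alpha> * P / \<beta> * (v / u - 1)) \<le> weighted_volume R (\<alpha> * v)"
proof -
  let ?E = "\<lambda>u p. exp (- (\<alpha> * u) * h p)"
  let ?W = "\<lambda>u p. indicator (D R) p * ?E u p"
  let ?M = "\<lambda>p. indicator (D R) p * (h p * ?E u p)"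
  have int: "integrable dv (?W u)" "integrable dv (?W v)" "integrable dv ?M"
    by (intro integrable_D integrable_weight continuous_intros continuous_h)+
  have "?W u p - ?W v p \<le> \<alpha> * (v - u) * ?M p" for p
  proof -
    have "?E v p = ?E u p * exp (- (\<alpha> * (v - u) * h p))"
      by (simp add: exp_add[symmetric] algebra_simps)
    moreover have "1 - \<alpha> * (v - u) * h p \<le> exp (- (\<alpha> * (v - u) * h p))"
      using exp_ge_add_one_self[of "- (\<alpha> * (v - u) * h p)"] by simp
    ultimately have "?E u p * (1 - \<alpha> * (v - u) * h p) \<le> ?E v p" by simp
    then show ?thesis by (simp add: indicator_def algebra_simps)
  qed
  then have "(\<integral>p. ?W u p - ?W v p \<partial>dv) \<le> (\<integral>p. \<alpha> * (v - u) * ?M p \<partial>dv)"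
    using int by (intro integral_mono) auto
  then have *: "weighted_volume R (\<alpha> * u) - weighted_volume R (\<alpha> * v) \<le> \<alpha> * (v - u) * integral\<^sup>L dv ?M"
    using int by (simp add: weighted_volume_def)
  have "integral\<^sup>L dv ?M \<le> P * weighted_volume R (\<alpha> * u) / (\<beta> * u)"
    using weighted_moment_le[of u] u \<beta> by (simp add: pos_le_divide_eq mult.commute)
  then have "\<alpha> * (v - u) * integral\<^sup>L dv ?M \<le> \<alpha> * (v - u) * (P * weighted_volume R (\<alpha> * u) / (\<beta> * u))"
    using \<alpha> u by (intro mult_left_mono) auto
  also have "\<dots> = weighted_volume R (\<alpha> * u) * (\<alpha> * P / \<beta> * (v / u - 1))"
    using u \<beta> by (simp add: field_simps)
  finally show ?thesis using * by (simp add: right_diff_distrib)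
qed

text \<open>On the grid \<open>exp (- x + i * x / n)\<close> consecutive points have the same ratio,
  so every step contributes the same factor \<open>w n\<close>, and its n-th power converges to the
  required exponential.\<close>

lemma weighted_volume_growth:
  assumes x: "x \<ge> 0"
  shows "weighted_volume R (\<alpha> * exp (- x)) * exp (- (\<alpha> * P / \<beta>) * x) \<le> weighted_volume R \<alpha>"
proof -
  let ?q = "\<alpha> * P / \<beta>"
  define w where "w n = 1 - ?q * (exp (x / real n) - 1)" for n
  have grid: "weighted_volume R (\<alpha> * exp (- x)) * w n ^ i \<le> weighted_volume R (\<alpha> * exp (- x + real i * (x / real n)))"
    if n: "n > 0" "0 \<le> w n" and "i \<le> n" for n i
    using \<open>i \<le> n\<close>
  proof (induction i)
    case (Suc i)
    let ?u = "exp (- x + real i * (x / real n))" and ?v = "exp (- x + real (Suc i) * (x / real n))"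
    have "real (Suc i) * (x / real n) \<le> real n * (x / real n)"
      using Suc.prems x by (intro mult_right_mono) auto
    then have v1: "?v \<le> 1" using n(1) by simp
    have "real i * (x / real n) \<le> real (Suc i) * (x / real n)"
      using x by (intro mult_right_mono) auto
    then have uv: "?u \<le> ?v" by simp
    have ratio: "?v / ?u = exp (x / real n)"
      by (simp add: exp_diff[symmetric] add_divide_distrib algebra_simps)
    have "weighted_volume R (\<alpha> * exp (- x)) * w n ^ Suc i =
        weighted_volume R (\<alpha> * exp (- x)) * w n ^ i * w n" by simp
    also have "\<dots> \<le> weighted_volume R (\<alpha> * ?u) * w n"
      using Suc n(2) by (intro mult_right_mono) auto
    also have "\<dots> \<le> weighted_volume R (\<alpha> * ?v)"
      using weighted_volume_step[OF _ uv v1] by (simp only: ratio w_def exp_gt_zero)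
    finally show ?case .
  qed simp
  \<comment> \<open>Chaining the steps multiplies inequalities by \<open>w n\<close>, which has to
    be nonnegative; for large \<open>n\<close> it is, whatever the sign and size of
    \<open>P\<close>.\<close>
  have ev: "\<forall>\<^sub>F n in sequentially. 0 \<le> w n"
  proof -
    have "w \<longlonglongrightarrow> 1" unfolding w_def[abs_def] by real_asymp
    then have "\<forall>\<^sub>F n in sequentially. 0 < w n" by (rule order_tendstoD) simp
    then show ?thesis by (rule eventually_mono) simp
  qed
  have bound: "\<forall>\<^sub>F n in sequentially. weighted_volume R (\<alpha> * exp (- x)) * w n ^ n \<le> weighted_volume R \<alpha>"
    using ev eventually_gt_at_top[of 0]
  proof eventually_elim
    case (elim n)
    then show ?case using grid[of n n] by simp
  qed
  have lim: "(\<lambda>n. weighted_volume R (\<alpha> * exp (- x)) * w n ^ n) \<longlonglongrightarrow>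
      weighted_volume R (\<alpha> * exp (- x)) * exp (- ?q * x)"
    unfolding w_def by (intro tendsto_mult tendsto_const one_minus_exp_power_tendsto)
  show ?thesis by (rule tendsto_upperbound[OF lim bound]) simp
qed

text \<open>The choice \<open>x = \<epsilon> * (\<beta> / \<alpha>)\<close> turns the growth
  exponent into \<open>\<epsilon> * P\<close>, and \<open>h \<le> R\<close> bounds the weight below
  by \<open>exp (- s * R)\<close>. Allowing \<epsilon> = 0 yields the second estimate of the theorem
  as well.\<close>

lemma measure_D_le:
  assumes "\<epsilon> \<ge> 0"
  shows "measure dv (D R) \<le> weighted_volume R \<alpha> * exp (\<epsilon> * P + \<alpha> * R / exp (\<epsilon> * (\<beta> / \<alpha>)))"
proof -
  let ?x = "\<epsilon> * (\<beta> / \<alpha>)"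
  let ?s = "\<alpha> * exp (- ?x)"
  have fin: "emeasure dv (D R) < \<infinity>" by (rule emeasure_dv_compact[OF compact_D])
  have D: "D R \<in> sets dv" using borel_D by simp
  have "(\<integral>p. exp (- ?s * R) * indicator (D R) p \<partial>dv) \<le> weighted_volume R ?s"
    unfolding weighted_volume_def
  proof (rule integral_mono[OF _ integrable_weight])
    show "integrable dv (\<lambda>p. exp (- ?s * R) * indicator (D R) p)"
      using D fin by (intro integrable_mult_right integrable_real_indicator) auto
    show "exp (- ?s * R) * indicator (D R) p \<le> indicator (D R) p * exp (- ?s * h p)" for p
      using \<alpha> by (auto simp: indicator_def)
  qed
  then have "exp (- ?s * R) * measure dv (D R) \<le> weighted_volume R ?s" using D by simp
  then have "measure dv (D R) \<le> exp (?s * R) * weighted_volume R ?s"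
    by (simp add: exp_minus field_simps)
  moreover have "weighted_volume R ?s \<le> exp (\<epsilon> * P) * weighted_volume R \<alpha>"
  proof -
    have "(\<alpha> * P / \<beta>) * ?x = \<epsilon> * P" using \<alpha> \<beta> by simp
    then have "weighted_volume R ?s * exp (- (\<epsilon> * P)) \<le> weighted_volume R \<alpha>"
      using weighted_volume_growth[of ?x] assms \<alpha> \<beta> by (simp add: mult.commute)
    then show ?thesis by (simp add: exp_minus field_simps)
  qed
  ultimately have "measure dv (D R) \<le> exp (?s * R) * (exp (\<epsilon> * P) * weighted_volume R \<alpha>)"
    by (meson exp_ge_zero mult_left_mono order_trans)
  also have "\<dots> = weighted_volume R \<alpha> * exp (\<epsilon> * P + \<alpha> * R / exp ?x)"
    by (simp add: exp_add exp_minus divide_inverse mult_ac)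
  finally show ?thesis .
qed

end

section \<open>Exhaustion by sublevel sets and finiteness of the total integral\<close>

lemma sublevel_eq_D: "0 \<le> r \<Longrightarrow> sublevel h r = D (r\<^sup>2 / 4)"
proof -
  assume r: "0 \<le> r"
  have "2 * sqrt (h p) \<le> r \<longleftrightarrow> h p \<le> r\<^sup>2 / 4" for p
  proof -
    have "2 * sqrt (h p) \<le> r \<longleftrightarrow> sqrt (h p) \<le> sqrt ((r / 2)\<^sup>2)" using r by auto
    then show ?thesis by (simp only: real_sqrt_le_iff power_divide) simp
  qed
  then show ?thesis by (simp add: sublevel_def)
qed

lemma weighted_volume_mono:
  assumes "R \<le> R'"
  shows "weighted_volume R s \<le> weighted_volume R' s"
  unfolding weighted_volume_def
  by (rule integral_mono[OF integrable_weight integrable_weight]) (use assms in \<open>auto simp: indicator_def\<close>)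

text \<open>On the shell outside \<open>D R\<close> the weight is at most
  \<open>exp (- s * R)\<close>. The shell is measured by all of \<open>D R'\<close>, since that
  volume is already under control.\<close>

lemma weighted_volume_increment:
  assumes "0 \<le> s"
  shows "weighted_volume R' s \<le> weighted_volume R s + exp (- s * R) * measure dv (D R')"
proof -
  have D: "D R' \<in> sets dv" using borel_D by simp
  have int: "integrable dv (\<lambda>p. exp (- s * R) * indicator (D R') p)"
    using D emeasure_dv_compact[OF compact_D, of R'] by (intro integrable_mult_right integrable_real_indicator) auto
  have le: "indicator (D R') p * exp (- s * h p) \<le>
      indicator (D R) p * exp (- s * h p) + exp (- s * R) * indicator (D R') p" for p
  proof (cases "h p \<le> R")
    case False
    then have "s * R \<le> s * h p" using assms by (intro mult_left_mono) auto
    then show ?thesis by (simp add: indicator_def)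
  qed (simp add: indicator_def)
  have "weighted_volume R' s \<le> (\<integral>p. indicator (D R) p * exp (- s * h p) + exp (- s * R) * indicator (D R') p \<partial>dv)"
    unfolding weighted_volume_def using int le
    by (intro integral_mono integrable_weight Bochner_Integration.integrable_add)
  also have "\<dots> = weighted_volume R s + exp (- s * R) * measure dv (D R')"
    unfolding weighted_volume_def
    by (subst Bochner_Integration.integral_add[OF integrable_weight int]) (use D in simp)
  finally show ?thesis .
qed

lemma nn_integral_weight:
  "(\<integral>\<^sup>+p. ennreal (indicator (D R) p * exp (- s * h p)) \<partial>dv) = ennreal (weighted_volume R s)"
  unfolding weighted_volume_def by (rule nn_integral_eq_integral[OF integrable_weight]) (auto intro: AE_I2)

lemma weighted_volume_le_total:
  "ennreal (weighted_volume R s) \<le> (\<integral>\<^sup>+p. ennreal (exp (- s * h p)) \<partial>dv)"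
  unfolding nn_integral_weight[symmetric]
  by (intro nn_integral_mono ennreal_leI) (auto simp: indicator_def)

lemma nn_integral_total_le:
  assumes "\<And>k. weighted_volume ((real k)\<^sup>2 / 4) s \<le> M"
  shows "(\<integral>\<^sup>+p. ennreal (exp (- s * h p)) \<partial>dv) \<le> ennreal M"
proof -
  let ?f = "\<lambda>k p. ennreal (indicator (D ((real k)\<^sup>2 / 4)) p * exp (- s * h p))"
  have "(SUP k. ?f k p) = ennreal (exp (- s * h p))" for p
  proof (rule antisym)
    show "(SUP k. ?f k p) \<le> ennreal (exp (- s * h p))"
      by (intro SUP_least ennreal_leI) (auto simp: indicator_def)
    \<comment> \<open>With \<open>k \<ge> 1\<close> also \<open>k \<le> k^2\<close>, so
      \<open>4 * h p \<le> k^2\<close> and the point lies in the k-th sublevel set.\<close>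
    obtain k where k: "4 * h p + 1 \<le> real k" using real_arch_simple by blast
    then have "real k * 1 \<le> real k * real k" using h_nonneg[of p] by (intro mult_left_mono) auto
    then have "h p \<le> (real k)\<^sup>2 / 4" using k h_nonneg[of p] unfolding power2_eq_square by linarith
    then have "?f k p = ennreal (exp (- s * h p))" by simp
    then show "ennreal (exp (- s * h p)) \<le> (SUP k. ?f k p)" 
      by (intro SUP_upper2[of k]) simp_all
  qed
  then have "(\<integral>\<^sup>+p. ennreal (exp (- s * h p)) \<partial>dv) = (\<integral>\<^sup>+p. (SUP k. ?f k p) \<partial>dv)" by simp
  also have "\<dots> = (SUP k. integral\<^sup>N dv (?f k))"
  proof (rule nn_integral_monotone_convergence_SUP)
    show "incseq ?f"
    proof (intro incseq_SucI le_funI ennreal_leI)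
      fix k p
      have "(real k)\<^sup>2 \<le> (real (Suc k))\<^sup>2" by (intro power_mono) auto
      then have "h p \<le> (real k)\<^sup>2 / 4 \<Longrightarrow> h p \<le> (real (Suc k))\<^sup>2 / 4" by linarith
      then show "indicator (D ((real k)\<^sup>2 / 4)) p * exp (- s * h p)
          \<le> indicator (D ((real (Suc k))\<^sup>2 / 4)) p * exp (- s * h p)"
        unfolding indicator_def by (cases "h p \<le> (real k)\<^sup>2 / 4") (simp_all only: mem_Collect_eq, simp_all)
    qed
    show "?f k \<in> borel_measurable dv" for k
      by (intro measurable_compose[OF _ measurable_ennreal] borel_measurable_integrable integrable_weight)
  qed
  also have "\<dots> \<le> ennreal M"
    unfolding nn_integral_weight by (intro SUP_least ennreal_leI assms)
  finally show ?thesis .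
qed

context
  fixes \<alpha> \<beta> a0 a1 a2 :: real
  assumes \<alpha>: "\<alpha> > 0" and \<beta>: "\<beta> > 0" and a2: "a2 < \<beta> / 4"
    and ineq1: "\<And>r p. r > 0 \<Longrightarrow> h p \<le> r\<^sup>2 / 4 \<Longrightarrow> \<Delta> p - \<alpha> * \<Gamma> p + \<beta> * h p \<le> a2 * r\<^sup>2 + a1 * r + a0"
    and ineq2: "\<And>r p. r > 0 \<Longrightarrow> h p \<le> r\<^sup>2 / 4 \<Longrightarrow> \<Delta> p \<le> a2 * r\<^sup>2 + a1 * r + a0"
begin

lemma volume_le:
  assumes r: "r > 0" and \<epsilon>: "\<epsilon> \<ge> 0"
  shows "measure dv (D (r\<^sup>2 / 4)) \<le> weighted_volume (r\<^sup>2 / 4) \<alpha> *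
    exp (\<epsilon> * (a2 * r\<^sup>2 + a1 * r + a0) + \<alpha> * r\<^sup>2 / (4 * exp (\<epsilon> * (\<beta> / \<alpha>))))"
proof -
  have "measure dv (D (r\<^sup>2 / 4)) \<le> weighted_volume (r\<^sup>2 / 4) \<alpha> *
      exp (\<epsilon> * (a2 * r\<^sup>2 + a1 * r + a0) + \<alpha> * (r\<^sup>2 / 4) / exp (\<epsilon> * (\<beta> / \<alpha>)))"
    by (rule measure_D_le[OF \<alpha> \<beta> _ _ \<epsilon>]) (rule ineq1[OF r] ineq2[OF r]; assumption)+
  then show ?thesis by simp
qed

text \<open>The volume bound contains the weighted volume it helps to estimate. Its coefficient is
  Gaussian small for large indices, so the term can be moved to the left, leaving a recursion with a
  convergent product.\<close>

lemma weighted_volume_bounded: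
  obtains M where "\<And>k. weighted_volume ((real k)\<^sup>2 / 4) \<alpha> \<le> M"
proof -
  let ?I = "\<lambda>k. weighted_volume ((real k)\<^sup>2 / 4) \<alpha>"
  obtain \<epsilon> where \<epsilon>: "\<epsilon> > 0" "\<epsilon> * a2 + \<alpha> / (4 * exp (\<epsilon> * (\<beta> / \<alpha>))) < \<alpha> / 4"
    using exists_epsilon[OF \<alpha> \<beta> a2] by blast
  \<comment> \<open>\<open>- \<kappa>\<close>, \<open>b\<close> and \<open>c\<close> are the
    coefficients of \<open>k^2\<close>, \<open>k\<close> and 1 in the exponent \<open>- \<alpha> *
    (k - 1)^2 / 4 + \<epsilon> * (a2 * k^2 + a1 * k + a0) + \<alpha> * k^2 / (4 * exp (\<epsilon> *
    (\<beta> / \<alpha>)))\<close>; the first square belongs to the inner radius of the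
    shell.\<close>
  define \<kappa> where "\<kappa> = \<alpha> / 4 - (\<epsilon> * a2 + \<alpha> / (4 * exp (\<epsilon> * (\<beta> / \<alpha>))))"
  define b where "b = \<alpha> / 2 + \<epsilon> * a1"
  define c where "c = \<epsilon> * a0 - \<alpha> / 4"
  let ?e = "\<lambda>k. exp (- \<kappa> * (real k)\<^sup>2 + b * real k + c)"
  have "\<kappa> > 0" using \<epsilon>(2) by (simp add: \<kappa>_def)
  then obtain K0 where K0: "\<And>k. k \<ge> K0 \<Longrightarrow> ?e k \<le> 1 / (real k)\<^sup>2"
    using eventually_gaussian_le[of \<kappa> b c] by (auto simp: eventually_sequentially)
  have step: "?I (Suc m) * (1 - ?e (Suc m)) \<le> ?I m" for m
  proof -
    let ?r = "real (Suc m)"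
    let ?X = "\<epsilon> * (a2 * ?r\<^sup>2 + a1 * ?r + a0) + \<alpha> * ?r\<^sup>2 / (4 * exp (\<epsilon> * (\<beta> / \<alpha>)))"
    have "?I (Suc m) \<le> ?I m + exp (- \<alpha> * ((real m)\<^sup>2 / 4)) * measure dv (D (?r\<^sup>2 / 4))"
      using \<alpha> by (intro weighted_volume_increment) simp
    also have "\<dots> \<le> ?I m + exp (- \<alpha> * ((real m)\<^sup>2 / 4)) * (?I (Suc m) * exp ?X)"
      using \<epsilon>(1) by (intro add_left_mono mult_left_mono volume_le) auto
    also have "exp (- \<alpha> * ((real m)\<^sup>2 / 4)) * (?I (Suc m) * exp ?X) =
        ?I (Suc m) * exp (- \<alpha> * ((real m)\<^sup>2 / 4) + ?X)"
      by (simp only: exp_add[of "- \<alpha> * ((real m)\<^sup>2 / 4)" ?X] mult_ac)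
    also have "- \<alpha> * ((real m)\<^sup>2 / 4) + ?X = - \<kappa> * ?r\<^sup>2 + b * ?r + c"
    proof -
      have m: "real m = ?r - 1" by simp
      show ?thesis unfolding m \<kappa>_def b_def c_def
        by (simp add: power2_eq_square field_simps del: of_nat_Suc)
    qed
    finally show ?thesis by (simp add: right_diff_distrib)
  qed
  define K where "K = max K0 1"
  \<comment> \<open>The factor \<open>(k + 1) / k\<close> absorbs \<open>1 - 1 / k^2\<close> by
    telescoping: \<open>?I k * ((k + 1) / k)\<close> does not increase from \<open>K\<close> on. The
    maximum with 1 in \<open>K\<close> keeps the denominators positive.\<close>
  have rec: "?I (K + j) * ((real (K + j) + 1) / real (K + j)) \<le> ?I K * ((real K + 1) / real K)" for j
  proof (induction j)
    case (Suc j)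
    let ?m = "K + j"
    have m: "real ?m > 0" by (simp add: K_def)
    have "?e (Suc ?m) \<le> 1 / (real (Suc ?m))\<^sup>2" by (rule K0) (simp add: K_def)
    then have "?I (Suc ?m) * (1 - 1 / (real (Suc ?m))\<^sup>2) \<le> ?I (Suc ?m) * (1 - ?e (Suc ?m))"
      using weighted_volume_nonneg by (intro mult_left_mono) auto
    also have "\<dots> \<le> ?I ?m" by (rule step)
    finally have "?I (Suc ?m) * (1 - 1 / (real ?m + 1)\<^sup>2) * ((real ?m + 1) / real ?m)
        \<le> ?I ?m * ((real ?m + 1) / real ?m)"
      using m by (intro mult_right_mono) (auto simp: add.commute)
    moreover have "(1 - 1 / (y + 1)\<^sup>2) * ((y + 1) / y) = (y + 2) / (y + 1)" if "y > 0" for y :: real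
    proof -
      have nz: "y + 1 \<noteq> 0" "y \<noteq> 0" using that by auto
      then have "1 - 1 / (y + 1)\<^sup>2 = y * (y + 2) / (y + 1)\<^sup>2"
        by (simp add: eq_divide_eq left_diff_distrib) (simp add: power2_eq_square algebra_simps)
      then show ?thesis using nz by (simp add: power2_eq_square)
    qed
    ultimately have "?I (Suc ?m) * ((real ?m + 2) / (real ?m + 1)) \<le> ?I ?m * ((real ?m + 1) / real ?m)"
      using m by (simp only: mult.assoc)
    then show ?case using Suc.IH by (simp add: algebra_simps)
  qed simp
  have "?I k \<le> ?I K * ((real K + 1) / real K)" for k
  proof -
    have K: "real K > 0" by (simp add: K_def)
    have "?I k \<le> ?I (K + k)"
      by (intro weighted_volume_mono divide_right_mono power_mono) auto
    also have "\<dots> \<le> ?I (K + k) * ((real (K + k) + 1) / real (K + k))"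
      using mult_left_mono[of 1 "(real (K + k) + 1) / real (K + k)" "?I (K + k)"] K weighted_volume_nonneg
      by simp
    also have "\<dots> \<le> ?I K * ((real K + 1) / real K)" by (rule rec)
    finally show ?thesis .
  qed
  then show thesis using that by blast
qed

lemma total_finite: "(\<integral>\<^sup>+p. ennreal (exp (- \<alpha> * h p)) \<partial>dv) < \<infinity>"
proof -
  obtain M where "\<And>k. weighted_volume ((real k)\<^sup>2 / 4) \<alpha> \<le> M" by (rule weighted_volume_bounded) blast
  from nn_integral_total_le[OF this] show ?thesis
    using ennreal_less_top le_less_trans by (metis infinity_ennreal_def)
qed

lemma emeasure_sublevel_le:
  assumes r: "r > 0" and \<epsilon>: "\<epsilon> \<ge> 0"
  shows "emeasure dv (sublevel h r) \<le> (\<integral>\<^sup>+p. ennreal (exp (- \<alpha> * h p)) \<partial>dv) *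
    ennreal (exp (\<epsilon> * (a2 * r\<^sup>2 + a1 * r + a0) + \<alpha> * r\<^sup>2 / (4 * exp (\<epsilon> * (\<beta> / \<alpha>)))))"
    (is "_ \<le> _ * ennreal ?e")
proof -
  have "emeasure dv (sublevel h r) = ennreal (measure dv (D (r\<^sup>2 / 4)))"
    using r emeasure_dv_compact[OF compact_D, of "r\<^sup>2 / 4"]
    by (simp add: sublevel_eq_D emeasure_eq_ennreal_measure less_top[symmetric])
  also have "\<dots> \<le> ennreal (weighted_volume (r\<^sup>2 / 4) \<alpha> * ?e)"
    by (intro ennreal_leI volume_le r \<epsilon>)
  also have "\<dots> = ennreal (weighted_volume (r\<^sup>2 / 4) \<alpha>) * ennreal ?e"
    using weighted_volume_nonneg by (simp add: ennreal_mult)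
  also have "\<dots> \<le> (\<integral>\<^sup>+p. ennreal (exp (- \<alpha> * h p)) \<partial>dv) * ennreal ?e"
    by (intro mult_right_mono weighted_volume_le_total) simp
  finally show ?thesis .
qed

end

end

theorem theorem3p1:
  fixes \<A> :: "('a::{t2_space, second_countable_topology}, 'n::finite) chart set"
    and g :: "('a, 'n) metric"
    and h :: "'a \<Rightarrow> real"
    and \<alpha> \<beta> a0 a1 a2 :: real
  assumes "riemannian_manifold \<A> g"
    and "complete_riemannian \<A> g"
    and "\<not> compact (UNIV :: 'a set)"
    and "\<alpha> > 0" and "\<beta> > 0" and "a2 < \<beta> / 4"
    and "proper_fun h"
    and "\<And>x. h x \<ge> 0"
    and "Ck_manifold 2 \<A> h"
    and "\<And>r x. r > 0 \<Longrightarrow> x \<in> sublevel h r \<Longrightarrow>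
           laplacian \<A> g h x - \<alpha> * norm_sq \<A> g (gradient g h) x + \<beta> * h x
             \<le> a2 * r\<^sup>2 + a1 * r + a0"
    and "\<And>r x. r > 0 \<Longrightarrow> x \<in> sublevel h r \<Longrightarrow>
           laplacian \<A> g h x \<le> a2 * r\<^sup>2 + a1 * r + a0"
  shows
    "let dv = volume_measure \<A> g;
         V = (\<lambda>r. emeasure dv (sublevel h r));
         \<gamma> = \<beta> / \<alpha>;
         C = (\<integral>\<^sup>+x. ennreal (exp (- \<alpha> * h x)) \<partial>dv)
     in C < \<infinity> \<and>
        (\<forall>r>0.
           (\<forall>\<epsilon>>0. V r \<le> C * ennreal
              (exp (\<epsilon> * (a2 * r\<^sup>2 + a1 * r + a0) + \<alpha> * r\<^sup>2 / (4 * exp (\<epsilon> * \<gamma>))))) \<and>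
           V r \<le> C * ennreal (exp (\<alpha> / 4 * r\<^sup>2)))"
proof -
  interpret proper_C2 \<A> g h
    by unfold_locales (use assms in auto)
  have ineq: "\<Delta> x - \<alpha> * \<Gamma> x + \<beta> * h x \<le> a2 * r\<^sup>2 + a1 * r + a0"
    "\<Delta> x \<le> a2 * r\<^sup>2 + a1 * r + a0" if "r > 0" "h x \<le> r\<^sup>2 / 4" for r x
  proof -
    have "x \<in> sublevel h r" using that by (simp add: sublevel_eq_D)
    then show "\<Delta> x - \<alpha> * \<Gamma> x + \<beta> * h x \<le> a2 * r\<^sup>2 + a1 * r + a0"
      "\<Delta> x \<le> a2 * r\<^sup>2 + a1 * r + a0"
      using assms(10,11)[OF that(1)] by (simp_all add: norm_sq_gradient)
  qed
  have V: "emeasure dv (sublevel h r) \<le> (\<integral>\<^sup>+p. ennreal (exp (- \<alpha> * h p)) \<partial>dv) *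
      ennreal (exp (\<epsilon> * (a2 * r\<^sup>2 + a1 * r + a0) + \<alpha> * r\<^sup>2 / (4 * exp (\<epsilon> * (\<beta> / \<alpha>)))))"
    if "r > 0" "\<epsilon> \<ge> 0" for r \<epsilon>
    by (rule emeasure_sublevel_le[OF assms(4-6) _ _ that]) (rule ineq; assumption)+
  \<comment> \<open>The second estimate is the case \<epsilon> = 0 of the first.\<close>
  have "emeasure dv (sublevel h r) \<le> (\<integral>\<^sup>+p. ennreal (exp (- \<alpha> * h p)) \<partial>dv) * ennreal (exp (\<alpha> / 4 * r\<^sup>2))"
    if "r > 0" for r
    using V[OF that, of 0] by simp
  moreover have "(\<integral>\<^sup>+p. ennreal (exp (- \<alpha> * h p)) \<partial>dv) < \<infinity>"
    by (rule total_finite[OF assms(4-6)]) (rule ineq; assumption)+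
  ultimately show ?thesis
    unfolding Let_def using V[OF _ less_imp_le] by blast
qed

end
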